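(* Let $\mathcal{C},\mathcal{D}$ be small connected categories and let $F,G\colon\mathcal{C}\to\mathcal{D}$ be two functors. Then $$\mathrm{D}(\mathrm{B}F,\mathrm{B}G)\le \mathrm{wcD}(F,G)\le \mathrm{cD}(F,G).$$
   Context: Interval category: for $m\ge 0$, $\mathcal{I}_m$ has objects $0,1,\dots,m$ and its only non-identity arrows are: exactly one arrow $r\to s$ whenever $r$ is even and $s=r-1$ or $s=r+1$. Two functors $F,G\colon\mathcal{C}\to\mathcal{D}$ between small categories are homotopic, $F\simeq G$, if for some $m\ge 0$ there is a functor $H\colon\mathcal{C}\times\mathcal{I}_m\to\mathcal{D}$ with $H_0=F$ and $H_m=G$ (equivalently, $F$ and $G$ are joined by a finite zigzag of natural transformations). A small category is connected if any two objects are joined by a finite zigzag of arrows. Members of covers (subcategories) are not required to be connected. $\mathrm{B}$ denotes the classifying space functor (geometric realization of the nerve); $\mathrm{B}\mathcal{C}$ is a CW-complex with one $m$-cell for each non-degenerate $m$-simplex of the nerve. Geometric cover: a collection $\{\mathcal{U}_\lambda\}_{\lambda\in\Lambda}$ of subcategories of $\mathcal{C}$ such that for every sequence of composable arrows $f_1,\dots,f_n$ in $\mathcal{C}$ there is $\lambda\in\Lambda$ such that every $f_i$ belongs to $\mathcal{U}_\lambda$. Categorical homotopic distance: $\mathrm{cD}(F,G)$ is the least integer $n\ge 0$ such that there is a geometric cover $\{\mathcal{U}_0,\dots,\mathcal{U}_n\}$ of $\mathcal{C}$ with $F_{|\mathcal{U}_j}\simeq G_{|\mathcal{U}_j}$ for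 all $j$; it is $\infty$ if there is no such cover. Weak categorical homotopic distance: $\mathrm{wcD}(F,G)$ is the least integer $n\ge 0$ such that there is a geometric cover $\{\mathcal{U}_0,\dots,\mathcal{U}_n\}$ of $\mathcal{C}$ such that the continuous maps $\mathrm{B}F_{|\mathrm{B}\mathcal{U}_j}$ and $\mathrm{B}G_{|\mathrm{B}\mathcal{U}_j}$ are homotopic (as maps $\mathrm{B}\mathcal{U}_j\to\mathrm{B}\mathcal{D}$) for all $j$; it is $\infty$ if there is no such cover. Homotopic distance of continuous maps: for $f,g\colon X\to Y$ continuous, $\mathrm{D}(f,g)$ is the least integer $n\ge 0$ such that there is an open cover $\{U_0,\dots,U_n\}$ of $X$ with $f_{|U_j}$ homotopic to $g_{|U_j}$ (as maps $U_j\to Y$) for all $j$; it is $\infty$ if there is no such cover. *)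

theory Defs
  imports "HOL-Homology.Homology" "HOL-Library.Extended_Nat"
begin

section \<open>Small categories and functors\<close>

record ('o, 'a) cat =
  Obj :: "'o set"
  Arr :: "'a set"
  Dom :: "'a \<Rightarrow> 'o"
  Cod :: "'a \<Rightarrow> 'o"
  Ide :: "'o \<Rightarrow> 'a"
  Comp :: "'a \<Rightarrow> 'a \<Rightarrow> 'a"  \<comment> \<open>\<open>Comp C g f\<close> is \<open>g\<close> after \<open>f\<close>\<close>

locale category =
  fixes C :: "('o, 'a) cat"
  assumes Dom_closed: "f \<in> Arr C \<Longrightarrow> Dom C f \<in> Obj C"
    and Cod_closed: "f \<in> Arr C \<Longrightarrow> Cod C f \<in> Obj C"
    and Ide_closed: "x \<in> Obj C \<Longrightarrow> Ide C x \<in> Arr C"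
    and Dom_Ide: "x \<in> Obj C \<Longrightarrow> Dom C (Ide C x) = x"
    and Cod_Ide: "x \<in> Obj C \<Longrightarrow> Cod C (Ide C x) = x"
    and Comp_closed:
      "\<lbrakk>f \<in> Arr C; g \<in> Arr C; Cod C f = Dom C g\<rbrakk> \<Longrightarrow> Comp C g f \<in> Arr C"
    and Dom_Comp:
      "\<lbrakk>f \<in> Arr C; g \<in> Arr C; Cod C f = Dom C g\<rbrakk> \<Longrightarrow> Dom C (Comp C g f) = Dom C f"
    and Cod_Comp:
      "\<lbrakk>f \<in> Arr C; g \<in> Arr C; Cod C f = Dom C g\<rbrakk> \<Longrightarrow> Cod C (Comp C g f) = Cod C g"
    and Comp_Ide_right: "f \<in> Arr C \<Longrightarrow> Comp C f (Ide C (Dom C f)) = f"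
    and Comp_Ide_left: "f \<in> Arr C \<Longrightarrow> Comp C (Ide C (Cod C f)) f = f"
    and Comp_assoc:
      "\<lbrakk>f \<in> Arr C; g \<in> Arr C; h \<in> Arr C; Cod C f = Dom C g; Cod C g = Dom C h\<rbrakk>
        \<Longrightarrow> Comp C h (Comp C g f) = Comp C (Comp C h g) f"

definition connected_category :: "('o, 'a) cat \<Rightarrow> bool" where
  "connected_category C \<longleftrightarrow>
    category C \<and>
    (\<forall>x\<in>Obj C. \<forall>y\<in>Obj C. equivclp (\<lambda>u v. \<exists>f\<in>Arr C. Dom C f = u \<and> Cod C f = v) x y)"

record ('o, 'a, 'p, 'b) ftr =
  fobj :: "'o \<Rightarrow> 'p"
  farr :: "'a \<Rightarrow> 'b"

locale cat_functor = source: category C + target: category D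
  for C :: "('o, 'a) cat" and D :: "('p, 'b) cat" +
  fixes F :: "('o, 'a, 'p, 'b) ftr"
  assumes fobj_closed: "x \<in> Obj C \<Longrightarrow> fobj F x \<in> Obj D"
    and farr_closed: "f \<in> Arr C \<Longrightarrow> farr F f \<in> Arr D"
    and Dom_farr: "f \<in> Arr C \<Longrightarrow> Dom D (farr F f) = fobj F (Dom C f)"
    and Cod_farr: "f \<in> Arr C \<Longrightarrow> Cod D (farr F f) = fobj F (Cod C f)"
    and farr_Ide: "x \<in> Obj C \<Longrightarrow> farr F (Ide C x) = Ide D (fobj F x)"
    and farr_Comp: "\<lbrakk>f \<in> Arr C; g \<in> Arr C; Cod C f = Dom C g\<rbrakk>
        \<Longrightarrow> farr F (Comp C g f) = Comp D (farr F g) (farr F f)"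

definition id_functor :: "('o, 'a, 'o, 'a) ftr" where
  "id_functor = \<lparr>fobj = (\<lambda>x. x), farr = (\<lambda>f. f)\<rparr>"

text \<open>The composite is cut down to the source category \<open>A\<close>, so that functors out of \<open>A\<close>
  which agree on \<open>A\<close> become equal as elements of the type.\<close>

definition compose_functor ::
    "('o, 'a) cat \<Rightarrow> ('p, 'b, 'q, 'c) ftr \<Rightarrow> ('o, 'a, 'p, 'b) ftr \<Rightarrow> ('o, 'a, 'q, 'c) ftr" where
  "compose_functor A G F =
    \<lparr>fobj = compose (Obj A) (fobj G) (fobj F), farr = compose (Arr A) (farr G) (farr F)\<rparr>"

definition subcategory :: "('o, 'a) cat \<Rightarrow> ('o, 'a) cat \<Rightarrow> bool" where
  "subcategory U C \<longleftrightarrow>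
    category U \<and> Obj U \<subseteq> Obj C \<and> Arr U \<subseteq> Arr C \<and>
    (\<forall>f\<in>Arr U. Dom U f = Dom C f \<and> Cod U f = Cod C f) \<and>
    (\<forall>x\<in>Obj U. Ide U x = Ide C x) \<and>
    (\<forall>f\<in>Arr U. \<forall>g\<in>Arr U. Cod U f = Dom U g \<longrightarrow> Comp U g f = Comp C g f)"

definition product_category ::
    "('o, 'a) cat \<Rightarrow> ('p, 'b) cat \<Rightarrow> ('o \<times> 'p, 'a \<times> 'b) cat" where
  "product_category C D =
    \<lparr>Obj = Obj C \<times> Obj D, Arr = Arr C \<times> Arr D,
     Dom = map_prod (Dom C) (Dom D), Cod = map_prod (Cod C) (Cod D),
     Ide = map_prod (Ide C) (Ide D),
     Comp = (\<lambda>g f. (Comp C (fst g) (fst f), Comp D (snd g) (snd f)))\<rparr>"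

text \<open>The category with object set \<open>A\<close> and exactly one arrow \<open>x \<rightarrow> y\<close>, namely the pair
  \<open>(x, y)\<close>, whenever \<open>R x y\<close>; it is a category if \<open>R\<close> is a preorder on \<open>A\<close>.\<close>

definition thin_category :: "'o set \<Rightarrow> ('o \<Rightarrow> 'o \<Rightarrow> bool) \<Rightarrow> ('o, 'o \<times> 'o) cat" where
  "thin_category A R =
    \<lparr>Obj = A, Arr = {(x, y). x \<in> A \<and> y \<in> A \<and> R x y},
     Dom = fst, Cod = snd, Ide = (\<lambda>x. (x, x)), Comp = (\<lambda>g f. (fst f, snd g))\<rparr>"

lemma category_thin_category:
  assumes "\<And>x. x \<in> A \<Longrightarrow> R x x"
    and "\<And>x y z. \<lbrakk>x \<in> A; y \<in> A; z \<in> A; R x y; R y z\<rbrakk> \<Longrightarrow> R x z"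
  shows "category (thin_category A R)"
  by unfold_locales (auto simp: thin_category_def intro: assms)

definition interval_category :: "nat \<Rightarrow> (nat, nat \<times> nat) cat" where
  "interval_category m =
    thin_category {..m} (\<lambda>r s. r = s \<or> (even r \<and> (s = r + 1 \<or> r = s + 1)))"

lemma category_interval_category: "category (interval_category m)"
  unfolding interval_category_def by (rule category_thin_category) auto

text \<open>Only the values of \<open>F\<close> and \<open>G\<close> on \<open>C\<close> enter, so for a subcategory \<open>U\<close> of the source of
  \<open>F\<close> and \<open>G\<close> the proposition \<open>homotopic_functors U D F G\<close> is the homotopy of their
  restrictions to \<open>U\<close>.\<close>

definition homotopic_functors ::
    "('o, 'a) cat \<Rightarrow> ('p, 'b) cat \<Rightarrow> ('o, 'a, 'p, 'b) ftr \<Rightarrow> ('o, 'a, 'p, 'b) ftr \<Rightarrow> bool" where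
  "homotopic_functors C D F G \<longleftrightarrow>
    (\<exists>m H. cat_functor (product_category C (interval_category m)) D H \<and>
      (\<forall>x\<in>Obj C. fobj H (x, 0) = fobj F x \<and> fobj H (x, m) = fobj G x) \<and>
      (\<forall>f\<in>Arr C. farr H (f, Ide (interval_category m) 0) = farr F f \<and>
                 farr H (f, Ide (interval_category m) m) = farr G f))"


section \<open>Geometric realization of simplicial sets\<close>

definition ordinal_category :: "nat \<Rightarrow> (nat, nat \<times> nat) cat" where
  "ordinal_category n = thin_category {..n} (\<le>)"

definition ordinal_maps :: "nat \<Rightarrow> nat \<Rightarrow> (nat \<Rightarrow> nat) set" where
  "ordinal_maps m n = {\<theta>. \<theta> \<in> {..m} \<rightarrow> {..n} \<and> mono_on {..m} \<theta>}"

text \<open>\<open>Act X m n \<theta> x \<in> Simp X m\<close> is the value at \<open>x \<in> Simp X n\<close> of the simplicial operator of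
  \<open>\<theta> : [m] \<rightarrow> [n]\<close>.\<close>

record 'x sset =
  Simp :: "nat \<Rightarrow> 'x set"
  Act :: "nat \<Rightarrow> nat \<Rightarrow> (nat \<Rightarrow> nat) \<Rightarrow> 'x \<Rightarrow> 'x"

text \<open>The affine map \<open>\<Delta>\<^sup>m \<rightarrow> \<Delta>\<^sup>n\<close> with vertex map \<open>\<theta>\<close>.\<close>

definition simplex_push :: "nat \<Rightarrow> (nat \<Rightarrow> nat) \<Rightarrow> (nat \<Rightarrow> real) \<Rightarrow> nat \<Rightarrow> real" where
  "simplex_push m \<theta> t = (\<lambda>j. \<Sum>i | i \<le> m \<and> \<theta> i = j. t i)"

type_synonym 'x cell_point = "(nat \<times> 'x) \<times> (nat \<Rightarrow> real)"

text \<open>The disjoint union of the \<open>Simp X n \<times> \<Delta>\<^sup>n\<close>, with \<open>Simp X n\<close> discrete.\<close>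

definition cell_space :: "'x sset \<Rightarrow> 'x cell_point topology" where
  "cell_space X =
    sum_topology (\<lambda>(n, x). subtopology (powertop_real UNIV) (standard_simplex n))
      (SIGMA n:UNIV. Simp X n)"

inductive gluing :: "'x sset \<Rightarrow> 'x cell_point \<Rightarrow> 'x cell_point \<Rightarrow> bool" for X where
  "\<lbrakk>\<theta> \<in> ordinal_maps m n; x \<in> Simp X n; t \<in> standard_simplex m\<rbrakk>
    \<Longrightarrow> gluing X ((m, Act X m n \<theta> x), t) ((n, x), simplex_push m \<theta> t)"

definition gluing_equiv :: "'x sset \<Rightarrow> ('x cell_point \<times> 'x cell_point) set" where
  "gluing_equiv X =
    {(p, q). p \<in> topspace (cell_space X) \<and> q \<in> topspace (cell_space X) \<and> equivclp (gluing X) p q}"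

definition quotient_topology :: "'a topology \<Rightarrow> ('a \<times> 'a) set \<Rightarrow> 'a set topology" where
  "quotient_topology X R =
    topology (\<lambda>\<U>. \<U> \<subseteq> topspace X // R \<and> openin X {x \<in> topspace X. R `` {x} \<in> \<U>})"

lemma openin_quotient_topology:
  "openin (quotient_topology X R) \<U> \<longleftrightarrow>
    \<U> \<subseteq> topspace X // R \<and> openin X {x \<in> topspace X. R `` {x} \<in> \<U>}"
proof -
  have "istopology (\<lambda>\<U>. \<U> \<subseteq> topspace X // R \<and> openin X {x \<in> topspace X. R `` {x} \<in> \<U>})"
    unfolding istopology_def
  proof (intro conjI allI impI)
    fix S T :: "'a set set"
    assume "S \<subseteq> topspace X // R \<and> openin X {x \<in> topspace X. R `` {x} \<in> S}"
      and "T \<subseteq> topspace X // R \<and> openin X {x \<in> topspace X. R `` {x} \<in> T}"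
    moreover have "{x \<in> topspace X. R `` {x} \<in> S \<inter> T} =
        {x \<in> topspace X. R `` {x} \<in> S} \<inter> {x \<in> topspace X. R `` {x} \<in> T}" by auto
    ultimately show "S \<inter> T \<subseteq> topspace X // R"
      and "openin X {x \<in> topspace X. R `` {x} \<in> S \<inter> T}" by auto
  next
    fix \<K> :: "'a set set set"
    assume K: "\<forall>K\<in>\<K>. K \<subseteq> topspace X // R \<and> openin X {x \<in> topspace X. R `` {x} \<in> K}"
    have "{x \<in> topspace X. R `` {x} \<in> \<Union>\<K>} = (\<Union>K\<in>\<K>. {x \<in> topspace X. R `` {x} \<in> K})" by auto
    with K show "\<Union>\<K> \<subseteq> topspace X // R"
      and "openin X {x \<in> topspace X. R `` {x} \<in> \<Union>\<K>}" by auto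
  qed
  then show ?thesis
    by (simp add: quotient_topology_def topology_inverse')
qed

lemma topspace_quotient_topology: "topspace (quotient_topology X R) = topspace X // R"
proof (rule subset_antisym)
  show "topspace (quotient_topology X R) \<subseteq> topspace X // R"
    using openin_quotient_topology openin_topspace by metis
  have "{x \<in> topspace X. R `` {x} \<in> topspace X // R} = topspace X"
    by (auto simp: quotient_def)
  then show "topspace X // R \<subseteq> topspace (quotient_topology X R)"
    by (simp add: openin_subset openin_quotient_topology)
qed

lemma quotient_map_quotient_topology:
  "quotient_map X (quotient_topology X R) (\<lambda>x. R `` {x})"
  unfolding quotient_map_def
  by (auto simp: openin_quotient_topology topspace_quotient_topology quotient_def)

definition realization :: "'x sset \<Rightarrow> 'x cell_point set topology" where
  "realization X = quotient_topology (cell_space X) (gluing_equiv X)"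

text \<open>The map of realizations induced by \<open>\<phi> : X \<rightarrow> Y\<close>, sending the class of \<open>((n, x), t)\<close> to the
  class of \<open>((n, \<phi> n x), t)\<close>; it depends on \<open>X\<close> only through its argument, a class of points of
  \<open>cell_space X\<close>.\<close>

definition realization_map ::
    "'y sset \<Rightarrow> (nat \<Rightarrow> 'x \<Rightarrow> 'y) \<Rightarrow> 'x cell_point set \<Rightarrow> 'y cell_point set" where
  "realization_map Y \<phi> c = gluing_equiv Y `` ((\<lambda>((n, x), t). ((n, \<phi> n x), t)) ` c)"


section \<open>Nerve and classifying space\<close>

text \<open>An \<open>n\<close>-simplex of the nerve, i.e. a string of \<open>n\<close> composable arrows together with its
  objects, is a functor \<open>[n] \<rightarrow> C\<close>; extensionality makes equal functors equal elements of the
  type. Operators act by precomposition, and deletion of an inner vertex composes two arrows.\<close>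

definition nerve :: "('o, 'a) cat \<Rightarrow> (nat, nat \<times> nat, 'o, 'a) ftr sset" where
  "nerve C =
    \<lparr>Simp = (\<lambda>n. {\<sigma>. cat_functor (ordinal_category n) C \<sigma> \<and>
               fobj \<sigma> \<in> extensional (Obj (ordinal_category n)) \<and>
               farr \<sigma> \<in> extensional (Arr (ordinal_category n))}),
     Act = (\<lambda>m n \<theta> \<sigma>. compose_functor (ordinal_category m) \<sigma> \<lparr>fobj = \<theta>, farr = map_prod \<theta> \<theta>\<rparr>)\<rparr>"

definition nerve_map ::
    "('o, 'a, 'p, 'b) ftr \<Rightarrow> nat \<Rightarrow> (nat, nat \<times> nat, 'o, 'a) ftr \<Rightarrow> (nat, nat \<times> nat, 'p, 'b) ftr"
  where "nerve_map F n \<sigma> = compose_functor (ordinal_category n) F \<sigma>"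

type_synonym ('o, 'a) cspace_point = "(nat, nat \<times> nat, 'o, 'a) ftr cell_point set"

definition classifying_space :: "('o, 'a) cat \<Rightarrow> ('o, 'a) cspace_point topology" where
  "classifying_space C = realization (nerve C)"

definition classifying_map ::
    "('p, 'b) cat \<Rightarrow> ('o, 'a, 'p, 'b) ftr \<Rightarrow> ('o, 'a) cspace_point \<Rightarrow> ('p, 'b) cspace_point" where
  "classifying_map D F = realization_map (nerve D) (nerve_map F)"


section \<open>Homotopic distances\<close>

definition geometric_cover :: "('o, 'a) cat \<Rightarrow> 'i set \<Rightarrow> ('i \<Rightarrow> ('o, 'a) cat) \<Rightarrow> bool" where
  "geometric_cover C I \<U> \<longleftrightarrow>
    (\<forall>i\<in>I. subcategory (\<U> i) C) \<and>
    (\<forall>fs. fs \<noteq> [] \<and> set fs \<subseteq> Arr C \<and> successively (\<lambda>f g. Cod C f = Dom C g) fs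
      \<longrightarrow> (\<exists>i\<in>I. set fs \<subseteq> Arr (\<U> i)))"

text \<open>In \<^typ>\<open>enat\<close>, \<open>Inf\<close> is the least element of a nonempty set, and \<open>Inf {} = \<infinity>\<close>.\<close>

definition cat_distance ::
    "('o, 'a) cat \<Rightarrow> ('p, 'b) cat \<Rightarrow> ('o, 'a, 'p, 'b) ftr \<Rightarrow> ('o, 'a, 'p, 'b) ftr \<Rightarrow> enat" where
  "cat_distance C D F G =
    Inf {enat n | n. \<exists>\<U>. geometric_cover C {..n} \<U> \<and>
                         (\<forall>j\<le>n. homotopic_functors (\<U> j) D F G)}"

text \<open>The restriction of \<open>BF\<close> to \<open>BU\<close> is its composite with the map \<open>BU \<rightarrow> BC\<close> induced by the
  inclusion of \<open>U\<close> into \<open>C\<close>.\<close>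

definition weak_cat_distance ::
    "('o, 'a) cat \<Rightarrow> ('p, 'b) cat \<Rightarrow> ('o, 'a, 'p, 'b) ftr \<Rightarrow> ('o, 'a, 'p, 'b) ftr \<Rightarrow> enat" where
  "weak_cat_distance C D F G =
    Inf {enat n | n. \<exists>\<U>. geometric_cover C {..n} \<U> \<and>
          (\<forall>j\<le>n. homotopic_with (\<lambda>_. True) (classifying_space (\<U> j)) (classifying_space D)
                   (classifying_map D F \<circ> classifying_map C id_functor)
                   (classifying_map D G \<circ> classifying_map C id_functor))}"

definition homotopic_distance ::
    "'a topology \<Rightarrow> 'b topology \<Rightarrow> ('a \<Rightarrow> 'b) \<Rightarrow> ('a \<Rightarrow> 'b) \<Rightarrow> enat" where
  "homotopic_distance X Y f g =
    Inf {enat n | n. \<exists>U. (\<forall>j\<le>n. openin X (U j)) \<and> (\<Union>j\<le>n. U j) = topspace X \<and>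
          (\<forall>j\<le>n. homotopic_with (\<lambda>_. True) (subtopology X (U j)) Y f g)}"

end

theory Submission
  imports Defs "HOL-Analysis.Abstract_Topological_Spaces"
begin

text \<open>
  The second inequality holds because a homotopy of functors \<open>H : U \<times> I\<^sub>m \<rightarrow> D\<close> is a zigzag of
  natural transformations, and a natural transformation is a functor on \<open>U \<times> [1]\<close>. On nerves it
  is a simplicial homotopy, and \<open>homotopic_realization_maps\<close> turns a simplicial homotopy into a
  homotopy of realizations by cutting every prism \<open>[0,1] \<times> \<Delta>\<^sup>n\<close> into \<open>n + 1\<close> simplices. So
  every geometric cover that is admissible for \<open>cD\<close> is admissible for \<open>wcD\<close>.

  For the first inequality let \<open>\<U>\<^sub>0, \<dots>, \<U>\<^sub>n\<close> be a geometric cover on whose members \<open>BF\<close> and \<open>BG\<close>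
  are homotopic. A simplex of the nerve of \<open>C\<close> is a string of composable arrows, so it lies in the
  nerve of some \<open>\<U>\<^sub>j\<close>; hence the subcomplexes \<open>B\<U>\<^sub>j\<close> cover \<open>BC\<close>. They are not open, but each has an
  open neighbourhood \<open>W\<^sub>j\<close> with a map \<open>r : W\<^sub>j \<rightarrow> B\<U>\<^sub>j\<close> whose composite with \<open>B\<U>\<^sub>j \<rightarrow> BC\<close> is
  homotopic to the inclusion of \<open>W\<^sub>j\<close> (\<open>deformable_neighbourhood\<close>). On \<open>W\<^sub>j\<close> this gives
  \<open>BF \<simeq> BF \<circ> r \<simeq> BG \<circ> r \<simeq> BG\<close>, so the \<open>W\<^sub>j\<close> form an admissible open cover for \<open>D\<close>.

  The neighbourhood is usually built skeleton by skeleton. Here it comes from one formula on every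
  simplex, which commutes with all simplicial operators and therefore passes to the quotient.
  Let \<open>A\<close> be a simplicial subset of \<open>X\<close>, let \<open>x\<close> be an \<open>n\<close>-simplex of \<open>X\<close> and \<open>K\<close> the set of faces
  \<open>S \<subseteq> {0..n}\<close> of \<open>x\<close> that lie in \<open>A\<close>. A point of \<open>\<Delta>\<^sup>n\<close> with barycentric coordinates \<open>t\<close> gives every
  vertex set \<open>S\<close> a mass \<open>t(S)\<close>. The coordinates are replaced by the weights \<open>t\<^sub>i \<rho>\<^sub>i\<close>, where
  \<open>\<rho>\<^sub>i \<in> [0,1]\<close> (\<open>retention\<close>) is \<open>0\<close> if \<open>{i} \<notin> K\<close>, and otherwise the smaller of
  \<open>1\<close> and the least positive part of \<open>(v\<^sub>i - t(S)) / (v\<^sub>i - q\<^sub>i(S))\<close>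
  over the faces \<open>S \<in> K\<close> that cannot be enlarged by \<open>i\<close> within \<open>K\<close>.
  Here \<open>v\<^sub>i\<close> is the largest mass of a face in \<open>K\<close> containing \<open>i\<close>, and \<open>q\<^sub>i(S)\<close> the largest mass of a
  part of \<open>S\<close> that can be enlarged by \<open>i\<close>. Three properties make this work.

  \<^item> The vertices of positive weight lie in every face of \<open>K\<close> of maximal mass, so they span a face in
    \<open>A\<close> (\<open>support_in_complex\<close>).
  \<^item> The weights commute with all operators (\<open>retention_simplex_push\<close>). For a degeneracy this is so
    because only masses of unions of fibres matter; for a face because a conflict of \<open>i\<close> with \<open>S\<close>
    that involves only vertices of mass \<open>0\<close> has \<open>q\<^sub>i(S) = t(S)\<close> and contributes the quotient \<open>1\<close>.
  \<^item> The weights are continuous in \<open>t\<close> (\<open>continuous_on_weight\<close>).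

  Where the total weight is positive, a point slides along a segment to its normalised weights. On
  a simplex of \<open>A\<close> there are no quotients and the total weight is \<open>1\<close>, so the region is a
  neighbourhood of \<open>A\<close>.
\<close>

section \<open>Points of the realization\<close>

lemma ordinal_maps_comp:
  "\<eta> \<in> ordinal_maps l m \<Longrightarrow> \<theta> \<in> ordinal_maps m n \<Longrightarrow> \<theta> \<circ> \<eta> \<in> ordinal_maps l n"
  by (auto simp: ordinal_maps_def mono_on_def Pi_iff)

lemma ordinal_maps_le: "\<theta> \<in> ordinal_maps m n \<Longrightarrow> i \<le> m \<Longrightarrow> \<theta> i \<le> n"
  by (auto simp: ordinal_maps_def)

lemma ordinal_maps_mono: "\<theta> \<in> ordinal_maps m n \<Longrightarrow> i \<le> j \<Longrightarrow> j \<le> m \<Longrightarrow> \<theta> i \<le> \<theta> j"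
  by (auto simp: ordinal_maps_def mono_on_def)

lemma ordinal_mapsI:
  "(\<And>i. i \<le> m \<Longrightarrow> \<theta> i \<le> n) \<Longrightarrow> (\<And>i j. i \<le> j \<Longrightarrow> j \<le> m \<Longrightarrow> \<theta> i \<le> \<theta> j) \<Longrightarrow> \<theta> \<in> ordinal_maps m n"
  by (auto simp: ordinal_maps_def mono_on_def)

text \<open>\<open>Act_cong\<close> is needed because an operator \<open>[m] \<rightarrow> [n]\<close> is encoded by a function on all of \<open>\<nat>\<close>.\<close>

locale simplicial_set =
  fixes X :: "'x sset"
  assumes Act_closed:
      "\<theta> \<in> ordinal_maps m n \<Longrightarrow> x \<in> Simp X n \<Longrightarrow> Act X m n \<theta> x \<in> Simp X m"
    and Act_Act:
      "\<eta> \<in> ordinal_maps l m \<Longrightarrow> \<theta> \<in> ordinal_maps m n \<Longrightarrow> x \<in> Simp X n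
        \<Longrightarrow> Act X l m \<eta> (Act X m n \<theta> x) = Act X l n (\<theta> \<circ> \<eta>) x"
    and Act_cong:
      "x \<in> Simp X n \<Longrightarrow> (\<And>i. i \<le> m \<Longrightarrow> \<theta> i = \<theta>' i) \<Longrightarrow> Act X m n \<theta> x = Act X m n \<theta>' x"
    and Act_id: "x \<in> Simp X n \<Longrightarrow> Act X n n (\<lambda>i. i) x = x"

lemma powertop_real_eq_euclidean: "powertop_real UNIV = (euclidean :: ('i \<Rightarrow> real) topology)"
  by (rule euclidean_product_topology)

lemma standard_simplexD:
  assumes "t \<in> standard_simplex n"
  shows "0 \<le> t i" "i > n \<Longrightarrow> t i = 0" "(\<Sum>i\<le>n. t i) = 1"
  using assms by (auto simp: standard_simplex_def)

lemma standard_simplexI: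
  assumes "\<And>i. 0 \<le> t i" and "\<And>i. i > n \<Longrightarrow> t i = 0" and sum: "(\<Sum>i\<le>n. t i) = 1"
  shows "t \<in> standard_simplex n"
proof -
  have "t i \<le> 1" for i
  proof (cases "i \<le> n")
    case True
    then have "t i \<le> (\<Sum>i\<le>n. t i)"
      using assms(1) by (intro member_le_sum) auto
    then show ?thesis using sum by simp
  qed (simp add: assms(2))
  then show ?thesis
    using assms by (simp add: standard_simplex_def)
qed

lemma sum_simplex_push:
  assumes "finite S"
  shows "sum (simplex_push m \<theta> t) S = sum t {i. i \<le> m \<and> \<theta> i \<in> S}"
proof -
  have "sum (simplex_push m \<theta> t) S = (\<Sum>j\<in>S. sum t {i \<in> {i. i \<le> m \<and> \<theta> i \<in> S}. \<theta> i = j})"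
  proof (rule sum.cong[OF refl])
    fix j assume "j \<in> S"
    then have "{i. i \<le> m \<and> \<theta> i = j} = {i \<in> {i. i \<le> m \<and> \<theta> i \<in> S}. \<theta> i = j}"
      by blast
    then show "simplex_push m \<theta> t j = sum t {i \<in> {i. i \<le> m \<and> \<theta> i \<in> S}. \<theta> i = j}"
      unfolding simplex_push_def by simp
  qed
  also have "\<dots> = sum t {i. i \<le> m \<and> \<theta> i \<in> S}"
    by (rule sum.group) (use assms in auto)
  finally show ?thesis .
qed

lemma sum_simplex_push_mult:
  assumes "\<theta> \<in> ordinal_maps m n"
  shows "(\<Sum>j\<le>n. simplex_push m \<theta> t j * f j) = (\<Sum>i\<le>m. t i * f (\<theta> i))"
proof -
  have "(\<Sum>j\<le>n. simplex_push m \<theta> t j * f j) = (\<Sum>j\<le>n. \<Sum>i | i \<in> {..m} \<and> \<theta> i = j. t i * f (\<theta> i))"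
    by (intro sum.cong) (auto simp: simplex_push_def sum_distrib_right intro!: sum.cong)
  also have "\<dots> = (\<Sum>i\<le>m. t i * f (\<theta> i))"
    by (rule sum.group) (use ordinal_maps_le[OF assms] in auto)
  finally show ?thesis .
qed

lemma simplex_push_closed:
  assumes "\<theta> \<in> ordinal_maps m n" and "t \<in> standard_simplex m"
  shows "simplex_push m \<theta> t \<in> standard_simplex n"
proof (rule standard_simplexI)
  show "0 \<le> simplex_push m \<theta> t i" for i
    unfolding simplex_push_def by (intro sum_nonneg) (use standard_simplexD[OF assms(2)] in auto)
  show "simplex_push m \<theta> t i = 0" if "i > n" for i
  proof -
    have "{j. j \<le> m \<and> \<theta> j = i} = {}"
      using that ordinal_maps_le[OF assms(1)] by fastforce
    then show ?thesis
      by (simp only: simplex_push_def sum.empty)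
  qed
  show "(\<Sum>i\<le>n. simplex_push m \<theta> t i) = 1"
    using sum_simplex_push_mult[OF assms(1), of t "\<lambda>_. 1"] standard_simplexD(3)[OF assms(2)] by simp
qed

lemma topspace_cell_space:
  "((n, x), t) \<in> topspace (cell_space X) \<longleftrightarrow> x \<in> Simp X n \<and> t \<in> standard_simplex n"
  by (auto simp: cell_space_def)

definition cell_class :: "'x sset \<Rightarrow> 'x cell_point \<Rightarrow> 'x cell_point set" where
  "cell_class X p = gluing_equiv X `` {p}"

lemma equiv_gluing_equiv: "equiv (topspace (cell_space X)) (gluing_equiv X)"
proof (rule equivI)
  show "refl_on (topspace (cell_space X)) (gluing_equiv X)"
    by (auto simp: refl_on_def gluing_equiv_def)
  show "sym (gluing_equiv X)"
    by (auto simp: sym_def gluing_equiv_def intro: equivclp_sym)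
  show "trans (gluing_equiv X)"
    by (auto simp: trans_def gluing_equiv_def intro: equivclp_trans)
qed (auto simp: gluing_equiv_def)

lemma cell_class_eq_iff:
  "p \<in> topspace (cell_space X) \<Longrightarrow> q \<in> topspace (cell_space X)
    \<Longrightarrow> cell_class X p = cell_class X q \<longleftrightarrow> equivclp (gluing X) p q"
  unfolding cell_class_def
  by (subst eq_equiv_class_iff[OF equiv_gluing_equiv]) (auto simp: gluing_equiv_def)

lemma topspace_realization: "topspace (realization X) = cell_class X ` topspace (cell_space X)"
  by (auto simp: realization_def topspace_quotient_topology quotient_def cell_class_def)

lemma quotient_map_cell_class: "quotient_map (cell_space X) (realization X) (cell_class X)"
  using quotient_map_quotient_topology[of "cell_space X" "gluing_equiv X"]
  by (simp add: realization_def cell_class_def[abs_def])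

lemma (in simplicial_set) cell_class_push:
  assumes "\<theta> \<in> ordinal_maps m n" and "x \<in> Simp X n" and "t \<in> standard_simplex m"
  shows "cell_class X ((m, Act X m n \<theta> x), t) = cell_class X ((n, x), simplex_push m \<theta> t)"
  using assms
  by (subst cell_class_eq_iff)
    (auto simp: topspace_cell_space Act_closed simplex_push_closed intro: r_into_equivclp gluing.intros)

text \<open>Invariance under a relation need only be checked where the function is defined, that is on \<open>V\<close>,
if \<open>V\<close> itself is invariant.\<close>

lemma equivclp_invariant:
  assumes "equivclp r p q" and "\<And>p q. r p q \<Longrightarrow> p \<in> V \<longleftrightarrow> q \<in> V"
    and "\<And>p q. r p q \<Longrightarrow> p \<in> V \<Longrightarrow> f p = f q"
  shows "(p \<in> V \<longleftrightarrow> q \<in> V) \<and> (p \<in> V \<longrightarrow> f p = f q)"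
  using assms(1)
proof (induction rule: equivclp_induct)
  case (step y z)
  then show ?case
    using assms(2)[of y z] assms(2)[of z y] assms(3)[of y z] assms(3)[of z y] by metis
qed simp

lemma cell_class_saturated:
  assumes "V \<subseteq> topspace (cell_space X)" and "\<And>p q. gluing X p q \<Longrightarrow> p \<in> V \<longleftrightarrow> q \<in> V"
  shows "{p \<in> topspace (cell_space X). cell_class X p \<in> cell_class X ` V} = V"
proof -
  have "p \<in> V" if "p \<in> topspace (cell_space X)" "q \<in> V" "cell_class X p = cell_class X q" for p q
  proof -
    have "equivclp (gluing X) p q"
      using that assms(1) cell_class_eq_iff[of p X q] by auto
    then have "p \<in> V \<longleftrightarrow> q \<in> V"
      using equivclp_invariant[of "gluing X" p q V "\<lambda>_. ()"] assms(2) by blast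
    then show ?thesis using that(2) by blast
  qed
  then show ?thesis
    using assms(1) by auto
qed

lemma openin_realization:
  assumes "openin (cell_space X) V" and sat: "\<And>p q. gluing X p q \<Longrightarrow> p \<in> V \<longleftrightarrow> q \<in> V"
  shows "openin (realization X) (cell_class X ` V)"
proof -
  have V: "V \<subseteq> topspace (cell_space X)"
    using assms(1) by (rule openin_subset)
  have sub: "cell_class X ` V \<subseteq> topspace (realization X)"
    using V by (auto simp: topspace_realization)
  have eq: "{p \<in> topspace (cell_space X). cell_class X p \<in> cell_class X ` V} = V"
    by (rule cell_class_saturated[OF V sat])
  have "\<forall>U. U \<subseteq> topspace (realization X) \<longrightarrow>
      (openin (cell_space X) {p \<in> topspace (cell_space X). cell_class X p \<in> U} \<longleftrightarrow> openin (realization X) U)"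
    using quotient_map_cell_class[of X] unfolding quotient_map_def by blast
  from this[rule_format, OF sub] show ?thesis
    unfolding eq using assms(1) by blast
qed

text \<open>Each cell is open in the disjoint union, so continuity can be checked on one cell at a time, also
after multiplication with a parameter space \<open>Z\<close> and restriction to \<open>V\<close>.\<close>

lemma continuous_map_cellwise:
  assumes V: "V \<subseteq> topspace (cell_space X)"
    and cont: "\<And>n x. x \<in> Simp X n \<Longrightarrow>
      continuous_map (prod_topology Z (top_of_set {t \<in> standard_simplex n. ((n, x), t) \<in> V})) Y
        (\<lambda>(z, t). h (z, ((n, x), t)))"
  shows "continuous_map (prod_topology Z (subtopology (cell_space X) V)) Y h"
proof (rule pasting_lemma)
  let ?C = "subtopology (cell_space X) V"
  let ?I = "SIGMA n:UNIV. Simp X n"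
  let ?T = "\<lambda>i. topspace Z \<times> {p \<in> V. fst p = i}"
  show "openin (prod_topology Z ?C) (?T i)" if "i \<in> ?I" for i
  proof -
    have "openin (cell_space X) {p \<in> topspace (cell_space X). fst p = i}"
    proof -
      have "{t. (j, t) \<in> {p \<in> topspace (cell_space X). fst p = i}}
          = (if j = i then standard_simplex (fst i) else {})" if "j \<in> ?I" for j
        using that by (auto simp: cell_space_def)
      moreover have "openin (subtopology (powertop_real UNIV) (standard_simplex n)) (standard_simplex n)" for n
        using openin_topspace[of "subtopology (powertop_real UNIV) (standard_simplex n)"] by simp
      ultimately show ?thesis
        unfolding cell_space_def openin_sum_topology by (auto simp: case_prod_beta)
    qed
    then have "openin ?C (V \<inter> {p \<in> topspace (cell_space X). fst p = i})"
      by (simp add: openin_subtopology_Int2)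
    moreover have "V \<inter> {p \<in> topspace (cell_space X). fst p = i} = {p \<in> V. fst p = i}"
      using V by blast
    ultimately show ?thesis
      by (simp add: openin_prod_Times_iff)
  qed
  show "continuous_map (subtopology (prod_topology Z ?C) (?T i)) Y h" if iI: "i \<in> ?I" for i
  proof -
    obtain n x where i: "i = (n, x)" and x: "x \<in> Simp X n"
      using iI by auto
    let ?S = "{t \<in> standard_simplex n. ((n, x), t) \<in> V}"
    have "continuous_map (subtopology (cell_space X) {p \<in> V. fst p = i}) (top_of_set ?S) snd"
    proof -
      have "continuous_map (subtopology (cell_space X) {p \<in> V. fst p = i})
          (subtopology (powertop_real UNIV) (standard_simplex n)) snd"
        unfolding continuous_map_def
      proof (intro conjI allI impI funcsetI)
        fix p assume "p \<in> topspace (subtopology (cell_space X) {p \<in> V. fst p = i})"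
        then show "snd p \<in> topspace (subtopology (powertop_real UNIV) (standard_simplex n))"
          using topspace_cell_space[of n x "snd p" X] i by (cases p) auto
      next
        fix U assume U: "openin (subtopology (powertop_real UNIV) (standard_simplex n)) U"
        have sub: "U \<subseteq> standard_simplex n"
          using openin_subset[OF U] by simp
        have "openin (cell_space X) ({i} \<times> U)"
        proof -
          have "{t. (j, t) \<in> {i} \<times> U} = (if j = i then U else {})" for j
            by auto
          then show ?thesis
            unfolding cell_space_def openin_sum_topology
            using U sub iI i by (auto simp: case_prod_beta)
        qed
        moreover have "{p \<in> topspace (subtopology (cell_space X) {p \<in> V. fst p = i}). snd p \<in> U}
            = {p \<in> V. fst p = i} \<inter> {i} \<times> U"
          using V by auto
        ultimately show "openin (subtopology (cell_space X) {p \<in> V. fst p = i})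
            {p \<in> topspace (subtopology (cell_space X) {p \<in> V. fst p = i}). snd p \<in> U}"
          by (simp add: openin_subtopology_Int2)
      qed
      then have "continuous_map (subtopology (cell_space X) {p \<in> V. fst p = i}) euclidean snd"
        by (simp add: powertop_real_eq_euclidean continuous_map_in_subtopology)
      moreover have "snd \<in> topspace (subtopology (cell_space X) {p \<in> V. fst p = i}) \<rightarrow> ?S"
        using V i by (auto simp: topspace_cell_space)
      ultimately show ?thesis
        by (simp add: continuous_map_in_subtopology)
    qed
    then have "continuous_map (prod_topology Z (subtopology (cell_space X) {p \<in> V. fst p = i}))
        (prod_topology Z (top_of_set ?S)) (\<lambda>(z, p). (z, snd p))"
      by (simp add: continuous_map_prod_top)
    then have "continuous_map (prod_topology Z (subtopology (cell_space X) {p \<in> V. fst p = i})) Y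
        ((\<lambda>(z, t). h (z, ((n, x), t))) \<circ> (\<lambda>(z, p). (z, snd p)))"
      using cont[OF x] by (rule continuous_map_compose)
    then have "continuous_map (prod_topology Z (subtopology (cell_space X) {p \<in> V. fst p = i})) Y h"
      by (rule continuous_map_eq) (auto simp: i)
    moreover have "subtopology (prod_topology Z ?C) (?T i)
        = prod_topology Z (subtopology (cell_space X) {p \<in> V. fst p = i})"
    proof -
      have "V \<inter> {p \<in> V. fst p = i} = {p \<in> V. fst p = i}" by blast
      then show ?thesis
        by (simp add: subtopology_Times subtopology_subtopology)
    qed
    ultimately show ?thesis by simp
  qed
  fix zp assume zp: "zp \<in> topspace (prod_topology Z ?C)"
  then have "fst (snd zp) \<in> ?I"
    using V topspace_cell_space[of _ _ _ X] by (cases zp) (force simp: cell_space_def)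
  then show "\<exists>j. j \<in> ?I \<and> zp \<in> ?T j \<and> h zp = h zp"
    using zp by (intro exI[of _ "fst (snd zp)"]) auto
qed auto

text \<open>How maps, and with \<open>Z = [0,1]\<close> homotopies, out of open parts of a realization are defined. As \<open>Z\<close>
is locally compact Hausdorff, its product with the quotient map from the disjoint union of
cells is again a quotient map; an open saturated part \<open>V\<close> inherits this.\<close>

lemma realization_descent:
  assumes Z: "locally_compact_space Z" "Hausdorff_space Z"
    and V: "openin (cell_space X) V"
    and sat: "\<And>p q. gluing X p q \<Longrightarrow> p \<in> V \<longleftrightarrow> q \<in> V"
    and inv: "\<And>z p q. z \<in> topspace Z \<Longrightarrow> gluing X p q \<Longrightarrow> p \<in> V \<Longrightarrow> h (z, p) = h (z, q)"
    and cont: "\<And>n x. x \<in> Simp X n \<Longrightarrow>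
      continuous_map (prod_topology Z (top_of_set {t \<in> standard_simplex n. ((n, x), t) \<in> V})) Y
        (\<lambda>(z, t). h (z, ((n, x), t)))"
  obtains k where
    "continuous_map (prod_topology Z (subtopology (realization X) (cell_class X ` V))) Y k"
    "\<And>z p. z \<in> topspace Z \<Longrightarrow> p \<in> V \<Longrightarrow> k (z, cell_class X p) = h (z, p)"
proof -
  have sub: "V \<subseteq> topspace (cell_space X)"
    using V by (rule openin_subset)
  have "quotient_map (subtopology (cell_space X) V)
      (subtopology (realization X) (cell_class X ` V)) (cell_class X)"
    using quotient_map_restriction[OF quotient_map_cell_class cell_class_saturated[OF sub sat]]
      openin_realization[OF V sat] by blast
  then have quo: "quotient_map (prod_topology Z (subtopology (cell_space X) V))
      (prod_topology Z (subtopology (realization X) (cell_class X ` V))) (\<lambda>(z, p). (z, cell_class X p))"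
    using Z by (intro quotient_map_prod_right) auto
  have h: "continuous_map (prod_topology Z (subtopology (cell_space X) V)) Y h"
    by (rule continuous_map_cellwise[OF sub cont])
  have "h zp = h zq"
    if zpq: "zp \<in> topspace (prod_topology Z (subtopology (cell_space X) V))"
      "zq \<in> topspace (prod_topology Z (subtopology (cell_space X) V))"
      "(\<lambda>(z, p). (z, cell_class X p)) zp = (\<lambda>(z, p). (z, cell_class X p)) zq" for zp zq
  proof -
    obtain z p q where z: "zp = (z, p)" "zq = (z, q)" "z \<in> topspace Z" "p \<in> V" "q \<in> V"
      and "cell_class X p = cell_class X q"
      using zpq by (cases zp; cases zq) auto
    then have "equivclp (gluing X) p q"
      using sub cell_class_eq_iff[of p X q] by auto
    then have "p \<in> V \<longrightarrow> h (z, p) = h (z, q)"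
      using equivclp_invariant[of "gluing X" p q V "\<lambda>p. h (z, p)"] sat inv[OF z(3)] by blast
    then show ?thesis using z by simp
  qed
  note respects = this
  show thesis
  proof (rule quotient_map_lift_exists[OF quo h respects])
    fix k
    assume k: "continuous_map (prod_topology Z (subtopology (realization X) (cell_class X ` V))) Y k"
      and eq: "\<And>zp. zp \<in> topspace (prod_topology Z (subtopology (cell_space X) V))
        \<Longrightarrow> k ((\<lambda>(z, p). (z, cell_class X p)) zp) = h zp"
    have "k (z, cell_class X p) = h (z, p)" if "z \<in> topspace Z" "p \<in> V" for z p
      using eq[of "(z, p)"] that sub by auto
    with k show thesis
      by (rule that)
  qed
qed

lemma continuous_map_cell_class:
  assumes "x \<in> Simp X n" and "continuous_map T (top_of_set (standard_simplex n)) f"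
  shows "continuous_map T (realization X) (\<lambda>s. cell_class X ((n, x), f s))"
proof -
  have "continuous_map (subtopology (powertop_real UNIV) (standard_simplex n)) (cell_space X) (\<lambda>t. ((n, x), t))"
    unfolding cell_space_def
    using continuous_map_component_injection[of "(n, x)" "SIGMA n:UNIV. Simp X n"
        "\<lambda>(n, x). subtopology (powertop_real UNIV) (standard_simplex n)"] assms(1) by simp
  then have "continuous_map T (cell_space X) ((\<lambda>t. ((n, x), t)) \<circ> f)"
    using assms(2) by (intro continuous_map_compose[of T "top_of_set (standard_simplex n)"])
      (simp_all add: powertop_real_eq_euclidean)
  then have "continuous_map T (realization X) (cell_class X \<circ> ((\<lambda>t. ((n, x), t)) \<circ> f))"
    using quotient_imp_continuous_map[OF quotient_map_cell_class] by (rule continuous_map_compose)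
  then show ?thesis
    by (simp add: o_def)
qed

section \<open>Maps of realizations\<close>

lemma continuous_map_cell_space:
  assumes "\<And>n x. x \<in> Simp X n \<Longrightarrow> continuous_map (top_of_set (standard_simplex n)) Y (\<lambda>t. f ((n, x), t))"
  shows "continuous_map (cell_space X) Y f"
proof -
  have "continuous_map (prod_topology (top_of_set {0::real})
      (subtopology (cell_space X) (topspace (cell_space X)))) Y (\<lambda>(z, p). f p)"
  proof (rule continuous_map_cellwise[OF subset_refl])
    fix n x assume x: "x \<in> Simp X n"
    have "{t \<in> standard_simplex n. ((n, x), t) \<in> topspace (cell_space X)} = standard_simplex n"
      using x by (auto simp: topspace_cell_space)
    moreover have "continuous_map (prod_topology (top_of_set {0::real}) (top_of_set (standard_simplex n))) Y
        ((\<lambda>t. f ((n, x), t)) \<circ> snd)"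
      by (rule continuous_map_compose[OF continuous_map_snd assms[OF x]])
    ultimately show "continuous_map (prod_topology (top_of_set {0::real})
        (top_of_set {t \<in> standard_simplex n. ((n, x), t) \<in> topspace (cell_space X)})) Y
        (\<lambda>(z, t). case (z, ((n, x), t)) of (z, p) \<Rightarrow> f p)"
      by (simp add: o_def case_prod_unfold)
  qed
  then have "continuous_map (cell_space X) Y ((\<lambda>(z, p). f p) \<circ> (\<lambda>p. (0::real, p)))"
    by (intro continuous_map_compose[of "cell_space X" "prod_topology (top_of_set {0::real}) (cell_space X)"])
      (auto simp: continuous_map_pairwise o_def)
  then show ?thesis
    by (simp add: o_def)
qed

definition simplicial_map :: "'x sset \<Rightarrow> 'y sset \<Rightarrow> (nat \<Rightarrow> 'x \<Rightarrow> 'y) \<Rightarrow> bool" where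
  "simplicial_map X Y \<phi> \<longleftrightarrow>
    (\<forall>n. \<forall>x\<in>Simp X n. \<phi> n x \<in> Simp Y n) \<and>
    (\<forall>m n. \<forall>\<theta>\<in>ordinal_maps m n. \<forall>x\<in>Simp X n. \<phi> m (Act X m n \<theta> x) = Act Y m n \<theta> (\<phi> n x))"

text \<open>\<open>realization_map\<close> takes the union of the classes of the images of all representatives; for a
simplicial map these are one and the same class.\<close>

lemma realization_map_cell_class:
  assumes \<phi>: "simplicial_map X Y \<phi>" and x: "x \<in> Simp X n" and t: "t \<in> standard_simplex n"
  shows "realization_map Y \<phi> (cell_class X ((n, x), t)) = cell_class Y ((n, \<phi> n x), t)"
proof -
  let ?f = "\<lambda>((n, x), t). ((n, \<phi> n x), t)"
  let ?p = "((n, x), t)"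
  have p: "?p \<in> topspace (cell_space X)"
    using x t by (simp add: topspace_cell_space)
  have top: "?f q \<in> topspace (cell_space Y)" if "q \<in> topspace (cell_space X)" for q
    using that \<phi> by (cases q) (auto simp: topspace_cell_space simplicial_map_def)
  have glue: "gluing Y (?f p) (?f q)" if "gluing X p q" for p q
    using that
  proof cases
    case (1 \<theta> m n x t)
    then have "?f p = ((m, Act Y m n \<theta> (\<phi> n x)), t)" "?f q = ((n, \<phi> n x), simplex_push m \<theta> t)"
      "\<phi> n x \<in> Simp Y n"
      using \<phi> by (auto simp: simplicial_map_def)
    then show ?thesis
      using 1 by (auto intro: gluing.intros)
  qed
  have "equivclp (gluing Y) (?f p) (?f q)" if "equivclp (gluing X) p q" for p q
    using that
  proof (induction rule: equivclp_induct)
    case (step y z)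
    then have "equivclp (gluing Y) (?f y) (?f z)"
      using glue[of y z] glue[of z y] by (blast intro: r_into_equivclp converse_r_into_equivclp)
    with step(3) show ?case
      by (rule equivclp_trans)
  qed simp
  then have "cell_class Y (?f q) = cell_class Y (?f ?p)" if "q \<in> cell_class X ?p" for q
  proof -
    have "q \<in> topspace (cell_space X)" "equivclp (gluing X) ?p q"
      using that by (auto simp: cell_class_def gluing_equiv_def)
    then show ?thesis
      using cell_class_eq_iff[OF top[OF p] top[of q]] \<open>\<And>p q. equivclp (gluing X) p q \<Longrightarrow> equivclp (gluing Y) (?f p) (?f q)\<close> by blast
  qed
  moreover have "?p \<in> cell_class X ?p"
    using p by (simp add: cell_class_def gluing_equiv_def)
  moreover have "realization_map Y \<phi> c = (\<Union>q\<in>c. cell_class Y (?f q))" for c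
    unfolding realization_map_def cell_class_def by blast
  ultimately have "realization_map Y \<phi> (cell_class X ?p) = cell_class Y (?f ?p)"
    by blast
  then show ?thesis by simp
qed

lemma continuous_map_realization_map:
  assumes \<phi>: "simplicial_map X Y \<phi>"
  shows "continuous_map (realization X) (realization Y) (realization_map Y \<phi>)"
proof -
  have "continuous_map (cell_space X) (realization Y) (realization_map Y \<phi> \<circ> cell_class X)"
  proof (rule continuous_map_cell_space)
    fix n x assume x: "x \<in> Simp X n"
    have "continuous_map (top_of_set (standard_simplex n)) (realization Y) (\<lambda>t. cell_class Y ((n, \<phi> n x), t))"
      using x \<phi> by (intro continuous_map_cell_class) (auto simp: simplicial_map_def)
    then show "continuous_map (top_of_set (standard_simplex n)) (realization Y)
        (\<lambda>t. (realization_map Y \<phi> \<circ> cell_class X) ((n, x), t))"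
      by (rule continuous_map_eq) (simp add: realization_map_cell_class[OF \<phi> x])
  qed
  then show ?thesis
    by (rule continuous_compose_quotient_map[OF quotient_map_cell_class])
qed

lemma simplex_push_comp:
  assumes \<eta>: "\<eta> \<in> ordinal_maps l m"
  shows "simplex_push m \<theta> (simplex_push l \<eta> t) = simplex_push l (\<theta> \<circ> \<eta>) t"
proof
  fix j
  have "simplex_push m \<theta> (simplex_push l \<eta> t) j = sum (simplex_push l \<eta> t) {i. i \<le> m \<and> \<theta> i = j}"
    by (simp add: simplex_push_def)
  also have "\<dots> = sum t {i. i \<le> l \<and> \<eta> i \<in> {i. i \<le> m \<and> \<theta> i = j}}"
    by (rule sum_simplex_push) simp
  also have "{i. i \<le> l \<and> \<eta> i \<in> {i. i \<le> m \<and> \<theta> i = j}} = {i. i \<le> l \<and> (\<theta> \<circ> \<eta>) i = j}"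
    using ordinal_maps_le[OF \<eta>] by auto
  finally show "simplex_push m \<theta> (simplex_push l \<eta> t) j = simplex_push l (\<theta> \<circ> \<eta>) t j"
    by (simp add: simplex_push_def)
qed

section \<open>Weights that pull a point into a subcomplex of a simplex\<close>

text \<open>Unlike a simplicial complex in the usual sense, \<open>K\<close> need not contain every vertex. The empty
face is included so that there always is a face of maximal mass.\<close>

definition simplicial_complex :: "nat \<Rightarrow> nat set set \<Rightarrow> bool" where
  "simplicial_complex n K \<longleftrightarrow> K \<subseteq> Pow {..n} \<and> {} \<in> K \<and> (\<forall>S\<in>K. \<forall>T\<subseteq>S. T \<in> K)"

text \<open>The mass of the heaviest part of \<open>S\<close> that can be enlarged by \<open>i\<close> within \<open>K\<close>. Since \<open>Q\<close> may contain
\<open>i\<close>, the value for \<open>S = UNIV\<close> is the largest mass of a face that contains \<open>i\<close>, if \<open>t\<close> is nonnegative.\<close>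

definition reach :: "nat set set \<Rightarrow> (nat \<Rightarrow> real) \<Rightarrow> nat \<Rightarrow> nat set \<Rightarrow> real" where
  "reach K t i S = Max (sum t ` {Q. Q \<subseteq> S \<and> insert i Q \<in> K})"

definition ratio :: "nat set set \<Rightarrow> (nat \<Rightarrow> real) \<Rightarrow> nat \<Rightarrow> nat set \<Rightarrow> real" where
  "ratio K t i S = (reach K t i UNIV - sum t S) / (reach K t i UNIV - reach K t i S)"

text \<open>How much of the coordinate of \<open>i\<close> survives: nothing if some face that cannot be enlarged by \<open>i\<close> is at
least as heavy as every face with \<open>i\<close>, everything if every face can be enlarged by \<open>i\<close>.\<close>

definition retention :: "nat set set \<Rightarrow> (nat \<Rightarrow> real) \<Rightarrow> nat \<Rightarrow> real" where
  "retention K t i =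
    (if {i} \<in> K then max 0 (Min (insert 1 (ratio K t i ` {S \<in> K. insert i S \<notin> K}))) else 0)"

lemma simplicial_complexD:
  assumes "simplicial_complex n K"
  shows "finite K" "S \<in> K \<Longrightarrow> finite S" "S \<in> K \<Longrightarrow> S \<subseteq> {..n}" "{} \<in> K"
    "S \<in> K \<Longrightarrow> T \<subseteq> S \<Longrightarrow> T \<in> K"
proof -
  have sub: "K \<subseteq> Pow {..n}"
    using assms by (simp add: simplicial_complex_def)
  then show "finite K"
    by (rule finite_subset) simp
  show "S \<in> K \<Longrightarrow> finite S"
    using sub finite_subset[of S "{..n}"] by auto
qed (use assms in \<open>auto simp: simplicial_complex_def\<close>)

lemma finite_link:
  assumes "simplicial_complex n K"
  shows "finite {Q. Q \<subseteq> S \<and> insert i Q \<in> K}"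
  by (rule finite_subset[of _ K])
    (use simplicial_complexD(1)[OF assms] simplicial_complexD(5)[OF assms] in blast)+

lemma reach_upper:
  assumes "simplicial_complex n K" and "Q \<subseteq> S" and "insert i Q \<in> K"
  shows "sum t Q \<le> reach K t i S"
  unfolding reach_def using finite_link[OF assms(1)] assms(2,3) by (intro Max_ge) auto

lemma reach_attained:
  assumes "simplicial_complex n K" and "{i} \<in> K"
  obtains Q where "Q \<subseteq> S" and "insert i Q \<in> K" and "reach K t i S = sum t Q"
proof -
  have "{} \<in> {Q. Q \<subseteq> S \<and> insert i Q \<in> K}"
    using assms(2) by simp
  then have "Max (sum t ` {Q. Q \<subseteq> S \<and> insert i Q \<in> K}) \<in> sum t ` {Q. Q \<subseteq> S \<and> insert i Q \<in> K}"
    using finite_link[OF assms(1)] by (intro Max_in) blast+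
  then show thesis
    using that unfolding reach_def by blast
qed

lemma reach_mono:
  assumes "simplicial_complex n K" and "{i} \<in> K" and "S \<subseteq> T"
  shows "reach K t i S \<le> reach K t i T"
proof -
  obtain Q where "Q \<subseteq> S" "insert i Q \<in> K" "reach K t i S = sum t Q"
    using reach_attained[OF assms(1,2)] by blast
  then show ?thesis
    using reach_upper[OF assms(1), of Q T i t] assms(3) by auto
qed

lemma reach_increment:
  assumes K: "simplicial_complex n K" and i: "{i} \<in> K" and "S \<subseteq> T" and "finite T"
    and t: "\<And>j. 0 \<le> t j"
  shows "reach K t i T \<le> reach K t i S + sum t (T - S)"
proof -
  obtain Q where Q: "Q \<subseteq> T" "insert i Q \<in> K" "reach K t i T = sum t Q"
    using reach_attained[OF K i] by blast
  have fin: "finite Q"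
    using Q(1) assms(4) finite_subset by blast
  have "insert i (Q \<inter> S) \<in> K"
    using simplicial_complexD(5)[OF K Q(2), of "insert i (Q \<inter> S)"] by blast
  then have "sum t (Q \<inter> S) \<le> reach K t i S"
    by (intro reach_upper[OF K]) auto
  moreover have "sum t (Q - S) \<le> sum t (T - S)"
    using Q(1) assms(4) t by (intro sum_mono2) auto
  moreover have "sum t Q = sum t (Q \<inter> S) + sum t (Q - S)"
    using sum.Int_Diff[OF fin] .
  ultimately show ?thesis
    using Q(3) by simp
qed

text \<open>Adding \<open>i\<close> to the heaviest compatible part of \<open>S\<close> gives a face containing \<open>i\<close>. The lemma keeps the
denominator of \<open>ratio\<close> away from \<open>0\<close> wherever vertex \<open>i\<close> has positive mass.\<close>

lemma reach_gap:
  assumes K: "simplicial_complex n K" and i: "{i} \<in> K" and "i \<notin> S"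
  shows "t i \<le> reach K t i UNIV - reach K t i S"
proof -
  obtain Q where Q: "Q \<subseteq> S" "insert i Q \<in> K" "reach K t i S = sum t Q"
    using reach_attained[OF K i] by blast
  have "finite Q" "i \<notin> Q"
    using simplicial_complexD(2)[OF K Q(2)] Q(1) assms(3) by auto
  then have "t i + sum t Q = sum t (insert i Q)"
    by simp
  also have "\<dots> \<le> reach K t i UNIV"
    using Q(2) by (intro reach_upper[OF K]) auto
  finally show ?thesis
    using Q(3) by simp
qed

lemma reach_le_sum:
  assumes K: "simplicial_complex n K" and i: "{i} \<in> K" and "finite S" and t: "\<And>j. 0 \<le> t j"
  shows "reach K t i S \<le> sum t S"
proof -
  obtain Q where "Q \<subseteq> S" "insert i Q \<in> K" "reach K t i S = sum t Q"
    using reach_attained[OF K i] by blast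
  then show ?thesis
    using assms(3) t by (auto intro: sum_mono2)
qed

lemma retention_nonneg: "0 \<le> retention K t i"
  by (simp add: retention_def)

lemma retention_le_1:
  assumes "simplicial_complex n K"
  shows "retention K t i \<le> 1"
proof -
  have "finite (ratio K t i ` {S \<in> K. insert i S \<notin> K})"
    using simplicial_complexD(1)[OF assms] by simp
  then have "Min (insert 1 (ratio K t i ` {S \<in> K. insert i S \<notin> K})) \<le> 1"
    by (intro Min_le) auto
  then show ?thesis
    by (auto simp: retention_def)
qed

lemma retention_le_ratio:
  assumes K: "simplicial_complex n K" and "{i} \<in> K" and "S \<in> K" and "insert i S \<notin> K"
  shows "retention K t i \<le> max 0 (ratio K t i S)"
proof -
  have "Min (insert 1 (ratio K t i ` {S \<in> K. insert i S \<notin> K})) \<le> ratio K t i S"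
    using simplicial_complexD(1)[OF K] assms(3,4) by (intro Min_le) auto
  then show ?thesis
    using assms(2) by (auto simp: retention_def)
qed

lemma retention_full:
  assumes "simplicial_complex n K" and "{..n} \<in> K" and "i \<le> n"
  shows "retention K t i = 1"
proof -
  have "insert i S \<in> K" if "S \<in> K" for S
    by (rule simplicial_complexD(5)[OF assms(1,2)])
      (use simplicial_complexD(3)[OF assms(1) that] assms(3) in auto)
  then have "{S \<in> K. insert i S \<notin> K} = {}"
    by blast
  moreover have "{i} \<in> K"
    using simplicial_complexD(5)[OF assms(1,2)] assms(3) by simp
  ultimately show ?thesis
    by (simp add: retention_def del: Collect_empty_eq)
qed

text \<open>Let \<open>S\<close> be a face of maximal mass. If \<open>i \<notin> S\<close> has positive mass, then \<open>S \<union> {i}\<close> would be heavier, so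
it is not a face; and no face with \<open>i\<close> is heavier than \<open>S\<close>, so the numerator of \<open>ratio K t i S\<close> is
not positive. Hence every vertex of positive weight lies in \<open>S\<close>.\<close>

lemma support_in_complex:
  assumes K: "simplicial_complex n K" and t: "\<And>j. 0 \<le> t j"
  shows "{i. 0 < t i * retention K t i} \<in> K"
proof -
  have fin: "finite (sum t ` K)" "sum t ` K \<noteq> {}"
    using simplicial_complexD[OF K] by auto
  obtain S where S: "S \<in> K" and "Max (sum t ` K) = sum t S"
    using Max_in[OF fin] by blast
  then have max: "sum t T \<le> sum t S" if "T \<in> K" for T
    using Max_ge[OF fin(1), of "sum t T"] that by simp
  have "i \<in> S" if "0 < t i * retention K t i" for i
  proof (rule ccontr)
    assume "i \<notin> S"
    have pos: "0 < t i" "0 < retention K t i"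
      using that t[of i] retention_nonneg[of K t i] by (auto simp: zero_less_mult_iff)
    then have i: "{i} \<in> K"
      by (auto simp: retention_def split: if_splits)
    have "finite S"
      using simplicial_complexD(2)[OF K S] .
    then have out: "insert i S \<notin> K"
      using max[of "insert i S"] pos(1) \<open>i \<notin> S\<close> by auto
    have "0 < reach K t i UNIV - reach K t i S"
      using reach_gap[OF K i \<open>i \<notin> S\<close>, of t] pos(1) by simp
    moreover have "reach K t i UNIV \<le> sum t S"
    proof -
      obtain Q where "insert i Q \<in> K" "reach K t i UNIV = sum t Q"
        using reach_attained[OF K i] by blast
      then show ?thesis
        using max simplicial_complexD(5)[OF K, of "insert i Q" Q] by auto
    qed
    ultimately have "ratio K t i S \<le> 0"
      by (simp add: ratio_def divide_nonpos_pos)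
    then show False
      using retention_le_ratio[OF K i S out, of t] pos(2) by simp
  qed
  then have "{i. 0 < t i * retention K t i} \<subseteq> S"
    by blast
  then show ?thesis
    by (rule simplicial_complexD(5)[OF K S])
qed

text \<open>When \<open>S\<close> grows to \<open>T\<close>, the numerator \<open>v - t(S)\<close> drops by the added mass \<open>b\<close> and the denominator
\<open>v - q(S)\<close> by some \<open>d \<le> b\<close>. Since the numerator is at most the denominator, the quotient drops too.\<close>

lemma ratio_antimono:
  assumes K: "simplicial_complex n K" and i: "{i} \<in> K" and "S \<subseteq> T" and T: "finite T"
    and "i \<notin> T" and pos: "0 < t i" and t: "\<And>j. 0 \<le> t j"
  shows "ratio K t i T \<le> ratio K t i S"
proof -
  define v where "v = reach K t i UNIV"
  define a where "a = sum t S"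
  define b where "b = sum t (T - S)"
  define q where "q = reach K t i S"
  define d where "d = reach K t i T - q"
  have "finite S"
    using assms(3) T finite_subset by blast
  have "sum t T = a + b"
    unfolding a_def b_def using sum.subset_diff[OF assms(3) T, of t] by simp
  then have "ratio K t i T = (v - (a + b)) / (v - (q + d))"
    by (simp add: ratio_def v_def d_def)
  moreover have d: "0 \<le> d" "d \<le> b"
    using reach_mono[OF K i assms(3), of t] reach_increment[OF K i assms(3) T, of t] t
    by (auto simp: d_def q_def b_def)
  moreover have q: "q \<le> a"
    using reach_le_sum[OF K i \<open>finite S\<close>, of t] t by (simp add: q_def a_def)
  moreover have gap: "0 < v - (q + d)"
    using reach_gap[OF K i assms(5), of t] pos by (simp add: v_def d_def)
  moreover have "(v - (a + b)) / (v - (q + d)) \<le> (v - a) / (v - q)"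
  proof -
    have "d * (v - a) \<le> b * (v - q)"
    proof (cases "0 \<le> v - a")
      case True
      then show ?thesis
        using d q by (intro mult_mono) auto
    next
      case False
      then have "d * (v - a) \<le> 0"
        using d by (simp add: mult_nonneg_nonpos)
      also have "0 \<le> b * (v - q)"
        using d gap by simp
      finally show ?thesis .
    qed
    then have "(v - (a + b)) * (v - q) \<le> (v - a) * (v - (q + d))"
      by (simp add: algebra_simps)
    moreover have "0 < v - q"
      using gap d by simp
    ultimately show ?thesis
      using gap by (simp only: pos_divide_le_eq times_divide_eq_left pos_le_divide_eq)
  qed
  moreover have "ratio K t i S = (v - a) / (v - q)"
    by (simp add: ratio_def v_def a_def q_def)
  ultimately show ?thesis
    by simp
qed

text \<open>Let \<open>t'\<close> be the push of \<open>t\<close>. For a vertex set \<open>S\<close> of \<open>[n]\<close> the preimage under \<open>\<theta>\<close> has the same mass and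
the same reach, hence the same ratio. So every ratio on \<open>[n]\<close> occurs on \<open>[m]\<close>, except when the preimage
can be enlarged by \<open>i\<close> although \<open>S\<close> cannot be enlarged by \<open>\<theta> i\<close>; then the ratio is \<open>1\<close> and does not
affect the minimum. Conversely a face of \<open>[m]\<close> need not be a preimage, but replacing it by
the preimage of its image only lowers the ratio.\<close>

lemma retention_simplex_push:
  assumes K: "simplicial_complex n K" and L: "simplicial_complex m L"
    and LK: "\<And>S. S \<subseteq> {..m} \<Longrightarrow> S \<in> L \<longleftrightarrow> \<theta> ` S \<in> K"
    and t: "\<And>j. 0 \<le> t j" and i: "i \<le> m" and pos: "0 < t i"
  shows "retention L t i = retention K (simplex_push m \<theta> t) (\<theta> i)"
proof (cases "{i} \<in> L")
  case False
  then show ?thesis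
    using LK[of "{i}"] i by (simp add: retention_def)
next
  case iL: True
  then have iK: "{\<theta> i} \<in> K"
    using LK[of "{i}"] i by simp
  define pre where "pre S = {i. i \<le> m \<and> \<theta> i \<in> S}" for S
  let ?t = "simplex_push m \<theta> t"
  have finpre: "finite (pre S)" for S
    unfolding pre_def by simp
  have mass: "sum ?t S = sum t (pre S)" if "S \<in> K" for S
    using sum_simplex_push simplicial_complexD(2)[OF K that] by (simp add: pre_def)
  have preL: "pre S \<in> L" if "S \<in> K" for S
    using LK[of "pre S"] simplicial_complexD(5)[OF K that, of "\<theta> ` pre S"]
    by (auto simp: pre_def)
  have imgK: "\<theta> ` S \<in> K" if "S \<in> L" for S
    using LK[of S] simplicial_complexD(3)[OF L that] that by blast
  have subpre: "S \<subseteq> pre (\<theta> ` S)" if "S \<in> L" for S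
    using simplicial_complexD(3)[OF L that] by (auto simp: pre_def)
  have reach: "reach L t i (pre S) = reach K ?t (\<theta> i) S" for S
  proof (rule antisym)
    obtain Q where Q: "Q \<subseteq> pre S" "insert i Q \<in> L" "reach L t i (pre S) = sum t Q"
      using reach_attained[OF L iL] by blast
    have QL: "Q \<in> L"
      using simplicial_complexD(5)[OF L Q(2), of Q] by blast
    have "insert (\<theta> i) (\<theta> ` Q) \<in> K"
      using imgK[OF Q(2)] by simp
    moreover have "\<theta> ` Q \<subseteq> S"
      using Q(1) by (auto simp: pre_def)
    ultimately have "sum ?t (\<theta> ` Q) \<le> reach K ?t (\<theta> i) S"
      by (intro reach_upper[OF K])
    moreover have "sum t Q \<le> sum t (pre (\<theta> ` Q))"
      using subpre[OF QL] finpre t by (intro sum_mono2) auto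
    ultimately show "reach L t i (pre S) \<le> reach K ?t (\<theta> i) S"
      using Q(3) mass[OF imgK[OF QL]] by simp
  next
    obtain Q where Q: "Q \<subseteq> S" "insert (\<theta> i) Q \<in> K" "reach K ?t (\<theta> i) S = sum ?t Q"
      using reach_attained[OF K iK] by blast
    have QK: "Q \<in> K"
      using simplicial_complexD(5)[OF K Q(2), of Q] by blast
    have "insert i (pre Q) \<in> L"
      using simplicial_complexD(5)[OF L preL[OF Q(2)], of "insert i (pre Q)"] i
      by (auto simp: pre_def)
    then have "sum t (pre Q) \<le> reach L t i (pre S)"
      using Q(1) by (intro reach_upper[OF L]) (auto simp: pre_def)
    then show "reach K ?t (\<theta> i) S \<le> reach L t i (pre S)"
      using Q(3) mass[OF QK] by simp
  qed
  have reachU: "reach L t i UNIV = reach K ?t (\<theta> i) UNIV"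
  proof -
    have "{Q. Q \<subseteq> UNIV \<and> insert i Q \<in> L} = {Q. Q \<subseteq> pre UNIV \<and> insert i Q \<in> L}"
      using simplicial_complexD(3)[OF L] by (auto simp: pre_def)
    then show ?thesis
      using reach[of UNIV] by (simp add: reach_def)
  qed
  have ratio: "ratio L t i (pre S) = ratio K ?t (\<theta> i) S" if "S \<in> K" for S
    by (simp add: ratio_def reach reachU mass[OF that])
  let ?A = "insert 1 (ratio L t i ` {S \<in> L. insert i S \<notin> L})"
  let ?B = "insert 1 (ratio K ?t (\<theta> i) ` {S \<in> K. insert (\<theta> i) S \<notin> K})"
  have fin: "finite ?A" "finite ?B"
    using simplicial_complexD(1)[OF K] simplicial_complexD(1)[OF L] by auto
  have "Min ?A = Min ?B"
  proof (rule antisym)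
    show "Min ?A \<le> Min ?B"
    proof (rule Min.boundedI[OF fin(2)])
      fix r assume "r \<in> ?B"
      then consider "r = 1" | S where "S \<in> K" "insert (\<theta> i) S \<notin> K" "r = ratio K ?t (\<theta> i) S"
        by auto
      then show "Min ?A \<le> r"
      proof cases
        case 1
        then show ?thesis using fin(1) by (intro Min_le) auto
      next
        case 2
        have r: "r = ratio L t i (pre S)"
          using 2 ratio by simp
        show ?thesis
        proof (cases "insert i (pre S) \<in> L")
          case False
          then show ?thesis
            using r preL[OF 2(1)] fin(1) by (intro Min_le) auto
        next
          case True
          have "i \<notin> pre S"
            using 2(1,2) by (auto simp: pre_def insert_absorb)
          then have "0 < reach L t i UNIV - reach L t i (pre S)"
            using reach_gap[OF L iL, of "pre S" t] pos by simp
          moreover have "reach L t i (pre S) = sum t (pre S)"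
            using reach_le_sum[OF L iL finpre t] reach_upper[OF L subset_refl True]
            by (intro antisym)
          ultimately have "r = 1"
            using r by (simp add: ratio_def)
          then show ?thesis using fin(1) by (intro Min_le) auto
        qed
      qed
    qed simp
  next
    show "Min ?B \<le> Min ?A"
    proof (rule Min.boundedI[OF fin(1)])
      fix r assume "r \<in> ?A"
      then consider "r = 1" | S where "S \<in> L" "insert i S \<notin> L" "r = ratio L t i S"
        by auto
      then show "Min ?B \<le> r"
      proof cases
        case 1
        then show ?thesis using fin(2) by (intro Min_le) auto
      next
        case 2
        have SK: "\<theta> ` S \<in> K"
          by (rule imgK[OF 2(1)])
        have out: "insert (\<theta> i) (\<theta> ` S) \<notin> K"
          using LK[of "insert i S"] i 2 simplicial_complexD(3)[OF L 2(1)] by auto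
        then have "i \<notin> pre (\<theta> ` S)"
          using SK by (auto simp: pre_def insert_absorb)
        then have "ratio L t i (pre (\<theta> ` S)) \<le> r"
          unfolding 2(3) by (intro ratio_antimono[OF L iL subpre[OF 2(1)] finpre]) (use pos t in auto)
        then have "ratio K ?t (\<theta> i) (\<theta> ` S) \<le> r"
          using ratio[OF SK] by simp
        moreover have "Min ?B \<le> ratio K ?t (\<theta> i) (\<theta> ` S)"
          using fin(2) SK out by (intro Min_le) auto
        ultimately show ?thesis by simp
      qed
    qed simp
  qed
  then show ?thesis
    using iL iK by (simp add: retention_def)
qed

lemma continuous_on_Max_image:
  fixes f :: "'i \<Rightarrow> 'a::topological_space \<Rightarrow> real"
  assumes "finite A" and "A \<noteq> {}" and "\<And>a. a \<in> A \<Longrightarrow> continuous_on S (f a)"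
  shows "continuous_on S (\<lambda>x. Max ((\<lambda>a. f a x) ` A))"
  using assms
proof (induction A rule: finite_ne_induct)
  case (insert a A)
  have "continuous_on S (\<lambda>x. max (f a x) (Max ((\<lambda>a. f a x) ` A)))"
    using insert by (intro continuous_on_max) auto
  then show ?case
    using insert by simp
qed simp

lemma continuous_on_Min_image:
  fixes f :: "'i \<Rightarrow> 'a::topological_space \<Rightarrow> real"
  assumes "finite A" and "A \<noteq> {}" and "\<And>a. a \<in> A \<Longrightarrow> continuous_on S (f a)"
  shows "continuous_on S (\<lambda>x. Min ((\<lambda>a. f a x) ` A))"
  using assms
proof (induction A rule: finite_ne_induct)
  case (insert a A)
  have "continuous_on S (\<lambda>x. min (f a x) (Min ((\<lambda>a. f a x) ` A)))"
    using insert by (intro continuous_on_min) auto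
  then show ?case
    using insert by simp
qed simp

text \<open>Where \<open>f\<close> vanishes, boundedness of \<open>g\<close> replaces its continuity.\<close>

lemma continuous_on_mult_bounded:
  fixes f g :: "'a::topological_space \<Rightarrow> real"
  assumes f: "continuous_on S f" and g: "continuous_on {x \<in> S. 0 < f x} g"
    and nonneg: "\<And>x. x \<in> S \<Longrightarrow> 0 \<le> f x" and bound: "\<And>x. x \<in> S \<Longrightarrow> \<bar>g x\<bar> \<le> 1"
  shows "continuous_on S (\<lambda>x. f x * g x)"
  unfolding continuous_on_def
proof
  fix x assume x: "x \<in> S"
  have flim: "(f \<longlongrightarrow> f x) (at x within S)"
    using f x by (simp add: continuous_on_def)
  show "((\<lambda>x. f x * g x) \<longlongrightarrow> f x * g x) (at x within S)"
  proof (cases "f x = 0")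
    case True
    have "((\<lambda>x. f x * g x) \<longlongrightarrow> 0) (at x within S)"
    proof (rule Lim_null_comparison)
      show "\<forall>\<^sub>F y in at x within S. norm (f y * g y) \<le> f y"
        unfolding eventually_at_filter
        using nonneg bound by (intro always_eventually) (auto simp: abs_mult intro: mult_left_le)
      show "(f \<longlongrightarrow> 0) (at x within S)"
        using flim True by simp
    qed
    then show ?thesis
      using True by simp
  next
    case False
    then have pos: "0 < f x"
      using nonneg[OF x] by simp
    then have ev: "\<forall>\<^sub>F y in at x within S. 0 < f y"
      using flim by (simp add: order_tendsto_iff)
    have "(g \<longlongrightarrow> g x) (at x within {x \<in> S. 0 < f x})"
      using g x pos by (auto simp: continuous_on_def)
    moreover have "at x within {x \<in> S. 0 < f x} = at x within S"
      by (rule filter_eqI) (use ev in \<open>auto simp: eventually_at_filter elim: eventually_elim2\<close>)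
    ultimately show ?thesis
      using flim by (intro tendsto_mult) simp_all
  qed
qed

lemma continuous_on_coordinate: "continuous_on T (\<lambda>t::nat \<Rightarrow> real. t i)"
  by (rule continuous_on_product_then_coordinatewise[OF continuous_on_id])

lemma continuous_on_reach:
  assumes "simplicial_complex n K" and "{i} \<in> K"
  shows "continuous_on T (\<lambda>t. reach K t i S)"
  unfolding reach_def
proof (rule continuous_on_Max_image[OF finite_link[OF assms(1)]])
  show "{Q. Q \<subseteq> S \<and> insert i Q \<in> K} \<noteq> {}"
  proof -
    have "{} \<in> {Q. Q \<subseteq> S \<and> insert i Q \<in> K}"
      using assms(2) by simp
    then show ?thesis by blast
  qed
qed (intro continuous_on_sum continuous_on_coordinate)

text \<open>\<open>retention K t i\<close> itself can jump where \<open>t i = 0\<close>. For the boundary of a triangle with vertices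
\<open>0, 1, 2\<close> and \<open>i = 1\<close>, it is \<open>1\<close> in the interior of the edge from \<open>0\<close> to \<open>1\<close>, but \<open>0\<close> at the points
near vertex \<open>0\<close> with \<open>t 1 = t 2 > 0\<close>. The factor \<open>t i\<close> repairs this.\<close>

lemma continuous_on_weight:
  assumes K: "simplicial_complex n K" and nonneg: "\<And>t i. t \<in> T \<Longrightarrow> 0 \<le> t i"
  shows "continuous_on T (\<lambda>t. t i * retention K t i)"
proof (cases "{i} \<in> K")
  case True
  show ?thesis
  proof (rule continuous_on_mult_bounded)
    show "continuous_on T (\<lambda>t. t i)"
      by (rule continuous_on_coordinate)
    show "\<bar>retention K t i\<bar> \<le> 1" for t
      using retention_le_1[OF K] retention_nonneg[of K t i] by simp
    show "continuous_on {t \<in> T. 0 < t i} (\<lambda>t. retention K t i)" (is "continuous_on ?P _")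
    proof -
      have ratio: "continuous_on ?P (\<lambda>t. ratio K t i S)" if "S \<in> K" "insert i S \<notin> K" for S
        unfolding ratio_def
      proof (intro continuous_on_divide continuous_on_diff continuous_on_reach[OF K True]
          continuous_on_sum continuous_on_coordinate ballI)
        fix t assume "t \<in> ?P"
        moreover have "i \<notin> S"
          using that by (auto simp: insert_absorb)
        ultimately show "reach K t i UNIV - reach K t i S \<noteq> 0"
          using reach_gap[OF K True, of S t] by auto
      qed
      let ?A = "{S \<in> K. insert i S \<notin> K}"
      have fin: "finite ?A"
        using simplicial_complexD(1)[OF K] by simp
      have "continuous_on ?P (\<lambda>t. Min (insert 1 ((\<lambda>S. ratio K t i S) ` ?A)))"
      proof (cases "?A = {}")
        case False
        then have "Min (insert 1 ((\<lambda>S. ratio K t i S) ` ?A)) = min 1 (Min ((\<lambda>S. ratio K t i S) ` ?A))" for t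
          using fin by (intro Min_insert) auto
        moreover have "continuous_on ?P (\<lambda>t. min 1 (Min ((\<lambda>S. ratio K t i S) ` ?A)))"
          using fin False ratio by (intro continuous_on_min continuous_on_Min_image) auto
        ultimately show ?thesis
          by simp
      qed (simp only: image_empty Min_singleton continuous_on_const)
      then show ?thesis
        using True unfolding retention_def by (auto intro: continuous_intros)
    qed
  qed (use nonneg in auto)
next
  case False
  then show ?thesis
    by (simp add: retention_def)
qed

section \<open>Open neighbourhoods of subcomplexes that deform into them\<close>

text \<open>The monotone retraction of \<open>\<nat>\<close> onto \<open>S\<close> that rounds down, or up to \<open>Min S\<close> below \<open>Min S\<close>. Composing
an \<open>n\<close>-simplex with it gives the face spanned by \<open>S\<close> as a degenerate simplex of the same dimension
\<open>n\<close>, so that the vertices of a face never have to be renumbered.\<close>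

definition vertex_retract :: "nat set \<Rightarrow> nat \<Rightarrow> nat" where
  "vertex_retract S i = Max {s \<in> S. s \<le> max i (Min S)}"

lemma vertex_retract:
  assumes "finite S" and "S \<noteq> {}"
  shows vertex_retract_in: "vertex_retract S i \<in> S"
    and vertex_retract_fix: "s \<in> S \<Longrightarrow> vertex_retract S s = s"
    and vertex_retract_mono: "i \<le> j \<Longrightarrow> vertex_retract S i \<le> vertex_retract S j"
proof -
  have ne: "{s \<in> S. s \<le> max i (Min S)} \<noteq> {}" for i
  proof -
    have "Min S \<in> {s \<in> S. s \<le> max i (Min S)}"
      using Min_in[OF assms] by simp
    then show ?thesis by blast
  qed
  have fin: "finite {s \<in> S. s \<le> max i (Min S)}" for i
    using assms(1) by simp
  show "vertex_retract S i \<in> S"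
    using Max_in[OF fin ne] by (auto simp: vertex_retract_def)
  show "vertex_retract S s = s" if "s \<in> S"
    unfolding vertex_retract_def
  proof (rule Max_eqI[OF fin])
    have "Min S \<le> s"
      using that assms(1) by simp
    then show "s' \<le> s" if "s' \<in> {s' \<in> S. s' \<le> max s (Min S)}" for s'
      using that by (simp add: max_def split: if_splits)
    show "s \<in> {s' \<in> S. s' \<le> max s (Min S)}"
      using that by simp
  qed
  show "vertex_retract S i \<le> vertex_retract S j" if "i \<le> j"
    unfolding vertex_retract_def using that by (intro Max_mono ne fin) auto
qed

lemma retract_ordinal_maps:
  assumes "S \<subseteq> {..n}" and "S \<noteq> {}"
  shows "vertex_retract S \<in> ordinal_maps m n"
proof -
  have "finite S"
    using assms(1) finite_subset by blast
  then show ?thesis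
    using vertex_retract_in[of S] vertex_retract_mono[of S] assms by (intro ordinal_mapsI) auto
qed

text \<open>The choice of \<open>\<kappa> j\<close> depends on \<open>j\<close> only through \<open>vertex_retract (\<theta> ` S) j\<close>, which makes \<open>\<kappa>\<close> monotone.\<close>

lemma vertex_retract_section:
  assumes \<theta>: "\<theta> \<in> ordinal_maps m n" and S: "S \<subseteq> {..m}" "S \<noteq> {}"
  obtains \<kappa> where "\<kappa> \<in> ordinal_maps n m" and "\<And>j. \<kappa> j \<in> S" and "\<And>j. \<theta> (\<kappa> j) = vertex_retract (\<theta> ` S) j"
proof -
  have fin: "finite (\<theta> ` S)" "\<theta> ` S \<noteq> {}"
    using S finite_subset by auto
  define \<kappa> where "\<kappa> j = (SOME s. s \<in> S \<and> \<theta> s = vertex_retract (\<theta> ` S) j)" for j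
  have \<kappa>: "\<kappa> j \<in> S \<and> \<theta> (\<kappa> j) = vertex_retract (\<theta> ` S) j" for j
    unfolding \<kappa>_def by (rule someI_ex) (use vertex_retract_in[OF fin, of j] in auto)
  have "\<kappa> \<in> ordinal_maps n m"
  proof (rule ordinal_mapsI)
    show "\<kappa> i \<le> m" for i
      using \<kappa> S(1) by blast
    fix i j :: nat assume "i \<le> j"
    then have le: "\<theta> (\<kappa> i) \<le> \<theta> (\<kappa> j)"
      using \<kappa> vertex_retract_mono[OF fin] by simp
    show "\<kappa> i \<le> \<kappa> j"
    proof (cases "vertex_retract (\<theta> ` S) i = vertex_retract (\<theta> ` S) j")
      case True
      then show ?thesis by (simp add: \<kappa>_def)
    next
      case False
      then have "\<theta> (\<kappa> i) < \<theta> (\<kappa> j)"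
        using le \<kappa> by simp
      then show ?thesis
        using ordinal_maps_mono[OF \<theta>, of "\<kappa> j" "\<kappa> i"] \<kappa> S(1)
        by (meson atMost_iff leD nle_le subsetD)
    qed
  qed
  then show thesis
    using \<kappa> that by blast
qed

lemma simplex_push_retract:
  assumes w: "\<And>i. i \<notin> S \<Longrightarrow> w i = 0" and S: "S \<subseteq> {..n}" "S \<noteq> {}"
  shows "simplex_push n (vertex_retract S) w = w"
proof
  fix j
  have fin: "finite S"
    using S(1) finite_subset by blast
  have "simplex_push n (vertex_retract S) w j = sum w {i \<in> S. i = j}"
    unfolding simplex_push_def
  proof (rule sum.mono_neutral_right)
    show "{i \<in> S. i = j} \<subseteq> {i. i \<le> n \<and> vertex_retract S i = j}"
      using S(1) vertex_retract_fix[OF fin S(2)] by auto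
    show "\<forall>i\<in>{i. i \<le> n \<and> vertex_retract S i = j} - {i \<in> S. i = j}. w i = 0"
      using w vertex_retract_fix[OF fin S(2)] by fastforce
  qed simp
  also have "{i \<in> S. i = j} = (if j \<in> S then {j} else {})"
    by auto
  finally show "simplex_push n (vertex_retract S) w j = w j"
    using w[of j] by (simp split: if_splits)
qed

locale simplicial_subset = simplicial_set X + sub: simplicial_set A for X A :: "'x sset" +
  assumes Simp_sub: "Simp A n \<subseteq> Simp X n" and Act_sub: "Act A = Act X"
begin

definition faces :: "nat \<Rightarrow> 'x \<Rightarrow> nat set set" where
  "faces n x = {S. S \<subseteq> {..n} \<and> (S = {} \<or> Act X n n (vertex_retract S) x \<in> Simp A n)}"

lemma Act_retract_retract:
  assumes x: "x \<in> Simp X n" and S: "S \<subseteq> {..n}" and T: "T \<subseteq> S" "T \<noteq> {}"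
  shows "Act X n n (vertex_retract T) (Act X n n (vertex_retract S) x) = Act X n n (vertex_retract T) x"
proof -
  have fin: "finite S" "finite T"
    using finite_subset[OF S] finite_subset[OF T(1)] by auto
  have ne: "S \<noteq> {}"
    using T by blast
  have "vertex_retract S (vertex_retract T i) = vertex_retract T i" for i
    using vertex_retract_fix[OF fin(1) ne] vertex_retract_in[OF fin(2) T(2)] T(1) by blast
  then have "vertex_retract S \<circ> vertex_retract T = vertex_retract T"
    by (simp add: fun_eq_iff)
  then show ?thesis
    using Act_Act[OF retract_ordinal_maps retract_ordinal_maps x, of T n S] S T ne by auto
qed

lemma simplicial_complex_faces:
  assumes x: "x \<in> Simp X n"
  shows "simplicial_complex n (faces n x)"
  unfolding simplicial_complex_def
proof (intro conjI ballI allI impI)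
  fix S T assume S: "S \<in> faces n x" and T: "T \<subseteq> S"
  show "T \<in> faces n x"
  proof (cases "T = {}")
    case False
    then have "Act X n n (vertex_retract S) x \<in> Simp A n" "S \<subseteq> {..n}"
      using S T by (auto simp: faces_def)
    then have "Act X n n (vertex_retract T) (Act X n n (vertex_retract S) x) \<in> Simp A n"
      using sub.Act_closed[OF retract_ordinal_maps[of T n n]] T False by (auto simp: Act_sub)
    then show ?thesis
      using Act_retract_retract[OF x _ T False] \<open>S \<subseteq> {..n}\<close> T by (auto simp: faces_def)
  qed (simp add: faces_def)
qed (auto simp: faces_def)

lemma Act_factor_face:
  assumes \<theta>: "\<theta> \<in> ordinal_maps m n" and x: "x \<in> Simp X n" and S: "S \<subseteq> {..m}" "S \<noteq> {}"
  shows "Act X m m (vertex_retract S) (Act X m n \<theta> x)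
    = Act X m n (\<theta> \<circ> vertex_retract S) (Act X n n (vertex_retract (\<theta> ` S)) x)"
proof -
  have fin: "finite S" "finite (\<theta> ` S)" "\<theta> ` S \<noteq> {}"
    using S finite_subset by auto
  have sub: "\<theta> ` S \<subseteq> {..n}"
    using ordinal_maps_le[OF \<theta>] S by auto
  have R: "vertex_retract S \<in> ordinal_maps m m" "vertex_retract (\<theta> ` S) \<in> ordinal_maps n n"
    using retract_ordinal_maps S sub fin by auto
  have "Act X m n (\<theta> \<circ> vertex_retract S) (Act X n n (vertex_retract (\<theta> ` S)) x)
      = Act X m n (vertex_retract (\<theta> ` S) \<circ> (\<theta> \<circ> vertex_retract S)) x"
    using R \<theta> x by (intro Act_Act ordinal_maps_comp)
  also have "\<dots> = Act X m n (\<theta> \<circ> vertex_retract S) x"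
    using x vertex_retract_fix[OF fin(2,3)] vertex_retract_in[OF fin(1) S(2)] by (intro Act_cong) auto
  also have "\<dots> = Act X m m (vertex_retract S) (Act X m n \<theta> x)"
    using R \<theta> x by (intro Act_Act[symmetric])
  finally show ?thesis by simp
qed

text \<open>The face of \<open>\<theta>\<^sup>* x\<close> spanned by \<open>S\<close> is a degeneracy of the face of \<open>x\<close> spanned by \<open>\<theta> ` S\<close>, and a section
\<open>\<kappa>\<close> of the degeneracy recovers the latter from the former.\<close>

lemma faces_Act:
  assumes \<theta>: "\<theta> \<in> ordinal_maps m n" and x: "x \<in> Simp X n" and S: "S \<subseteq> {..m}"
  shows "S \<in> faces m (Act X m n \<theta> x) \<longleftrightarrow> \<theta> ` S \<in> faces n x"
proof (cases "S = {}")
  case False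
  have fin: "finite S"
    using S finite_subset by blast
  have sub: "\<theta> ` S \<subseteq> {..n}"
    using ordinal_maps_le[OF \<theta>] S by auto
  have R: "vertex_retract S \<in> ordinal_maps m m"
    using retract_ordinal_maps S False by auto
  obtain \<kappa> where \<kappa>: "\<kappa> \<in> ordinal_maps n m" "\<And>j. \<kappa> j \<in> S" "\<And>j. \<theta> (\<kappa> j) = vertex_retract (\<theta> ` S) j"
    using vertex_retract_section[OF \<theta> S False] by blast
  have "Act X m m (vertex_retract S) (Act X m n \<theta> x) \<in> Simp A m \<longleftrightarrow> Act X n n (vertex_retract (\<theta> ` S)) x \<in> Simp A n"
  proof
    assume "Act X n n (vertex_retract (\<theta> ` S)) x \<in> Simp A n"
    then show "Act X m m (vertex_retract S) (Act X m n \<theta> x) \<in> Simp A m"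
      unfolding Act_factor_face[OF \<theta> x S False]
      using sub.Act_closed[OF ordinal_maps_comp[OF R \<theta>]] by (simp add: Act_sub)
  next
    assume *: "Act X m m (vertex_retract S) (Act X m n \<theta> x) \<in> Simp A m"
    have "Act X n m \<kappa> (Act X m m (vertex_retract S) (Act X m n \<theta> x)) = Act X n n (\<theta> \<circ> (vertex_retract S \<circ> \<kappa>)) x"
      using Act_Act[OF \<kappa>(1) R Act_closed[OF \<theta> x]] Act_Act[OF ordinal_maps_comp[OF \<kappa>(1) R] \<theta> x] by simp
    also have "\<dots> = Act X n n (vertex_retract (\<theta> ` S)) x"
      using x vertex_retract_fix[OF fin False] \<kappa>(2,3) by (intro Act_cong) auto
    finally show "Act X n n (vertex_retract (\<theta> ` S)) x \<in> Simp A n"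
      using sub.Act_closed[OF \<kappa>(1) *] by (simp add: Act_sub)
  qed
  then show ?thesis
    using S sub False by (simp add: faces_def)
qed (simp add: faces_def)

definition weight :: "nat \<Rightarrow> 'x \<Rightarrow> (nat \<Rightarrow> real) \<Rightarrow> nat \<Rightarrow> real" where
  "weight n x t i = t i * retention (faces n x) t i"

definition total :: "nat \<Rightarrow> 'x \<Rightarrow> (nat \<Rightarrow> real) \<Rightarrow> real" where
  "total n x t = (\<Sum>i\<le>n. weight n x t i)"

text \<open>Position at time \<open>s\<close> on the segment from \<open>t\<close> to the normalised weights.\<close>

definition slide :: "real \<Rightarrow> nat \<Rightarrow> 'x \<Rightarrow> (nat \<Rightarrow> real) \<Rightarrow> nat \<Rightarrow> real" where
  "slide s n x t i = (1 - s) * t i + s * (weight n x t i / total n x t)"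

lemma weight_nonneg: "t \<in> standard_simplex n \<Longrightarrow> 0 \<le> weight n x t i"
  using standard_simplexD(1) retention_nonneg by (simp add: weight_def)

lemma weight_push:
  assumes \<theta>: "\<theta> \<in> ordinal_maps m n" and x: "x \<in> Simp X n" and t: "t \<in> standard_simplex m"
  shows "simplex_push m \<theta> (weight m (Act X m n \<theta> x) t) = weight n x (simplex_push m \<theta> t)"
proof
  fix j
  have "weight m (Act X m n \<theta> x) t i = t i * retention (faces n x) (simplex_push m \<theta> t) (\<theta> i)" if "i \<le> m" for i
  proof (cases "t i = 0")
    case False
    have nonneg: "0 \<le> t i" for i
      by (rule standard_simplexD(1)[OF t])
    then have "0 < t i"
      using False by (simp add: order_less_le)
    then show ?thesis
      using retention_simplex_push[OF simplicial_complex_faces[OF x]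
          simplicial_complex_faces[OF Act_closed[OF \<theta> x]] faces_Act[OF \<theta> x] nonneg that]
      by (simp add: weight_def)
  qed (simp add: weight_def)
  then have "simplex_push m \<theta> (weight m (Act X m n \<theta> x) t) j
      = (\<Sum>i | i \<le> m \<and> \<theta> i = j. t i * retention (faces n x) (simplex_push m \<theta> t) j)"
    unfolding simplex_push_def by (intro sum.cong) auto
  then show "simplex_push m \<theta> (weight m (Act X m n \<theta> x) t) j = weight n x (simplex_push m \<theta> t) j"
    by (simp add: weight_def simplex_push_def sum_distrib_right)
qed

lemma total_push:
  assumes \<theta>: "\<theta> \<in> ordinal_maps m n" and x: "x \<in> Simp X n" and t: "t \<in> standard_simplex m"
  shows "total n x (simplex_push m \<theta> t) = total m (Act X m n \<theta> x) t"
  unfolding total_def weight_push[OF \<theta> x t, symmetric]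
  using sum_simplex_push_mult[OF \<theta>, of _ "\<lambda>_. 1"] by simp

lemma slide_push:
  assumes \<theta>: "\<theta> \<in> ordinal_maps m n" and x: "x \<in> Simp X n" and t: "t \<in> standard_simplex m"
  shows "simplex_push m \<theta> (slide s m (Act X m n \<theta> x) t) = slide s n x (simplex_push m \<theta> t)"
proof
  fix j
  let ?I = "{i. i \<le> m \<and> \<theta> i = j}"
  have "sum (slide s m (Act X m n \<theta> x) t) ?I
      = (1 - s) * sum t ?I + s * (sum (weight m (Act X m n \<theta> x) t) ?I / total m (Act X m n \<theta> x) t)"
    by (simp add: slide_def sum.distrib sum_distrib_left sum_divide_distrib)
  then show "simplex_push m \<theta> (slide s m (Act X m n \<theta> x) t) j = slide s n x (simplex_push m \<theta> t) j"
    using fun_cong[OF weight_push[OF \<theta> x t], of j] total_push[OF \<theta> x t]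
    by (simp add: slide_def simplex_push_def)
qed

lemma slide_closed:
  assumes t: "t \<in> standard_simplex n" and s: "s \<in> {0..1}" and pos: "0 < total n x t"
  shows "slide s n x t \<in> standard_simplex n"
proof (rule standard_simplexI)
  show "0 \<le> slide s n x t i" for i
    using s pos standard_simplexD(1)[OF t] weight_nonneg[OF t] by (simp add: slide_def)
  show "slide s n x t i = 0" if "i > n" for i
    using standard_simplexD(2)[OF t that] by (simp add: slide_def weight_def)
  have "(\<Sum>i\<le>n. slide s n x t i) = (1 - s) * (\<Sum>i\<le>n. t i) + s * ((\<Sum>i\<le>n. weight n x t i) / total n x t)"
    by (simp add: slide_def sum.distrib sum_distrib_left sum_divide_distrib)
  then show "(\<Sum>i\<le>n. slide s n x t i) = 1"
    using pos standard_simplexD(3)[OF t] by (simp add: total_def[symmetric])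
qed

lemma support_weight:
  assumes x: "x \<in> Simp X n" and t: "t \<in> standard_simplex n"
  shows "{i. 0 < weight n x t i} \<in> faces n x"
  unfolding weight_def
  by (rule support_in_complex[OF simplicial_complex_faces[OF x] standard_simplexD(1)[OF t]])

lemma support_weight_nonempty:
  assumes "t \<in> standard_simplex n" and "0 < total n x t"
  shows "{i. 0 < weight n x t i} \<noteq> {}"
proof
  assume "{i. 0 < weight n x t i} = {}"
  then have "weight n x t i = 0" for i
    using weight_nonneg[OF assms(1), of x i] by (metis (mono_tags) antisym_conv2 empty_iff mem_Collect_eq)
  then show False
    using assms(2) by (simp add: total_def)
qed

lemma continuous_on_weight_faces:
  assumes "x \<in> Simp X n" and "T \<subseteq> standard_simplex n"
  shows "continuous_on T (\<lambda>t. weight n x t i)"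
  unfolding weight_def
  using standard_simplexD(1) assms(2)
  by (intro continuous_on_weight[OF simplicial_complex_faces[OF assms(1)]]) auto

lemma continuous_on_total:
  assumes "x \<in> Simp X n" and "T \<subseteq> standard_simplex n"
  shows "continuous_on T (\<lambda>t. total n x t)"
  unfolding total_def by (intro continuous_on_sum continuous_on_weight_faces assms)

definition nbhd :: "'x cell_point set" where
  "nbhd = {((n, x), t) | n x t. x \<in> Simp X n \<and> t \<in> standard_simplex n \<and> 0 < total n x t}"

lemma nbhd_iff: "((n, x), t) \<in> nbhd \<longleftrightarrow> x \<in> Simp X n \<and> t \<in> standard_simplex n \<and> 0 < total n x t"
  by (auto simp: nbhd_def)

lemma openin_nbhd: "openin (cell_space X) nbhd"
proof -
  have "openin (top_of_set (standard_simplex n)) {t \<in> standard_simplex n. 0 < total n x t}"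
    if "x \<in> Simp X n" for n x
    using continuous_openin_preimage_gen[OF continuous_on_total[OF that subset_refl], of "{0<..}"]
    by (simp add: vimage_def Collect_conj_eq)
  moreover have "{t. ((n, x), t) \<in> nbhd} = {t \<in> standard_simplex n. 0 < total n x t}" if "x \<in> Simp X n" for n x
    using that by (auto simp: nbhd_iff)
  moreover have "nbhd \<subseteq> topspace (cell_space X)"
    by (auto simp: nbhd_def topspace_cell_space)
  ultimately show ?thesis
    unfolding cell_space_def openin_sum_topology by (auto simp: powertop_real_eq_euclidean)
qed

lemma gluing_nbhd:
  assumes "gluing X p q"
  shows "p \<in> nbhd \<longleftrightarrow> q \<in> nbhd"
  using assms
proof cases
  case (1 \<theta> m n x t)
  then show ?thesis
    using total_push[of \<theta> m n x t] Act_closed simplex_push_closed by (simp add: nbhd_iff)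
qed

text \<open>The end point of the slide, read in \<open>A\<close>: the simplex \<open>x\<close> is replaced by its face spanned by the
vertices of positive weight.\<close>

definition into_sub :: "'x cell_point \<Rightarrow> 'x cell_point set" where
  "into_sub = (\<lambda>((n, x), t).
    cell_class A ((n, Act X n n (vertex_retract {i. 0 < weight n x t i}) x), slide 1 n x t))"

text \<open>The simplex in \<open>A\<close> that carries the point \<open>w\<close> may be any face whose vertices include the support
of \<open>w\<close>. This gives continuity of \<open>into_sub\<close> where the support changes.\<close>

lemma cell_class_subface:
  assumes x: "x \<in> Simp X n" and S: "S \<in> faces n x" and T: "T \<subseteq> S" "T \<noteq> {}"
    and w: "w \<in> standard_simplex n" "\<And>i. i \<notin> T \<Longrightarrow> w i = 0"
  shows "cell_class A ((n, Act X n n (vertex_retract T) x), w) = cell_class A ((n, Act X n n (vertex_retract S) x), w)"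
proof -
  have S': "S \<subseteq> {..n}" "Act X n n (vertex_retract S) x \<in> Simp A n"
    using S T by (auto simp: faces_def)
  then have T': "T \<subseteq> {..n}"
    using T by auto
  have "cell_class A ((n, Act A n n (vertex_retract T) (Act X n n (vertex_retract S) x)), w)
      = cell_class A ((n, Act X n n (vertex_retract S) x), simplex_push n (vertex_retract T) w)"
    by (rule sub.cell_class_push[OF retract_ordinal_maps[OF T' T(2)] S'(2) w(1)])
  then show ?thesis
    using Act_retract_retract[OF x S'(1) T] simplex_push_retract[OF w(2) T' T(2)] by (simp add: Act_sub)
qed

lemma slide_1_support:
  assumes "t \<in> standard_simplex n" and "i \<notin> {i. 0 < weight n x t i}"
  shows "slide 1 n x t i = 0"
  using weight_nonneg[OF assms(1), of x i] assms(2) by (simp add: slide_def)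

lemma into_sub_gluing:
  assumes "gluing X p q" and "p \<in> nbhd"
  shows "into_sub p = into_sub q"
  using assms(1)
proof cases
  case (1 \<theta> m n x t)
  let ?y = "Act X m n \<theta> x"
  let ?u = "simplex_push m \<theta> t"
  let ?S = "{i. 0 < weight m ?y t i}"
  have y: "?y \<in> Simp X m"
    using 1 Act_closed by blast
  have pos: "0 < total m ?y t"
    using assms(2) 1 by (simp add: nbhd_iff)
  have S: "?S \<in> faces m ?y" "?S \<noteq> {}"
    using support_weight[OF y 1(5)] support_weight_nonempty[OF 1(5) pos] .
  have Sm: "?S \<subseteq> {..m}"
    using S(1) by (simp add: faces_def)
  have supp: "{j. 0 < weight n x ?u j} = \<theta> ` ?S"
  proof -
    have "0 < weight n x ?u j \<longleftrightarrow> (\<exists>i\<in>{i. i \<le> m \<and> \<theta> i = j}. 0 < weight m ?y t i)" for j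
    proof -
      have "weight n x ?u j = sum (weight m ?y t) {i. i \<le> m \<and> \<theta> i = j}"
        using fun_cong[OF weight_push[OF 1(3,4,5)], of j] by (simp add: simplex_push_def)
      moreover have "sum (weight m ?y t) {i. i \<le> m \<and> \<theta> i = j} = 0
          \<longleftrightarrow> (\<forall>i\<in>{i. i \<le> m \<and> \<theta> i = j}. weight m ?y t i = 0)"
        using weight_nonneg[OF 1(5)] by (intro sum_nonneg_eq_0_iff) auto
      ultimately show ?thesis
        using weight_nonneg[OF 1(5), of ?y] weight_nonneg[OF simplex_push_closed[OF 1(3,5)], of x j]
        by (metis (no_types, lifting) order_less_le)
    qed
    then show ?thesis
      using Sm by auto
  qed
  have "\<theta> ` ?S \<in> faces n x"
    using faces_Act[OF 1(3,4) Sm] S(1) by blast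
  then have z: "Act X n n (vertex_retract (\<theta> ` ?S)) x \<in> Simp A n"
    using S(2) by (auto simp: faces_def)
  have R: "vertex_retract ?S \<in> ordinal_maps m m"
    by (rule retract_ordinal_maps[OF Sm S(2)])
  have w: "slide 1 m ?y t \<in> standard_simplex m"
    using 1(5) pos by (intro slide_closed) auto
  have "into_sub p = cell_class A ((m, Act A m n (\<theta> \<circ> vertex_retract ?S) (Act X n n (vertex_retract (\<theta> ` ?S)) x)), slide 1 m ?y t)"
    using Act_factor_face[OF 1(3,4) Sm S(2)] by (simp add: into_sub_def 1(1) Act_sub)
  also have "\<dots> = cell_class A ((n, Act X n n (vertex_retract (\<theta> ` ?S)) x),
      simplex_push m (\<theta> \<circ> vertex_retract ?S) (slide 1 m ?y t))"
    by (rule sub.cell_class_push[OF ordinal_maps_comp[OF R 1(3)] z w])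
  also have "simplex_push m (\<theta> \<circ> vertex_retract ?S) (slide 1 m ?y t)
      = simplex_push m \<theta> (simplex_push m (vertex_retract ?S) (slide 1 m ?y t))"
    by (rule simplex_push_comp[OF R, symmetric])
  also have "\<dots> = slide 1 n x ?u"
    using simplex_push_retract[OF slide_1_support[OF 1(5)] Sm S(2)] slide_push[OF 1(3,4,5)] by simp
  finally show ?thesis
    by (simp add: into_sub_def 1(2) supp)
qed

lemma continuous_on_slide:
  assumes x: "x \<in> Simp X n" and T: "T \<subseteq> {t \<in> standard_simplex n. 0 < total n x t}"
  shows "continuous_on (I \<times> T) (\<lambda>(s, t). slide s n x t)"
proof -
  have sub: "T \<subseteq> standard_simplex n"
    using T by blast
  have snd: "continuous_on (I \<times> T) (\<lambda>p. f (snd p))" if "continuous_on T f" for f :: "_ \<Rightarrow> real"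
    by (rule continuous_on_compose2[OF that]) (auto intro: continuous_intros)
  have "continuous_on (I \<times> T) (\<lambda>p. slide (fst p) n x (snd p))"
    unfolding slide_def
  proof (intro continuous_on_coordinatewise_then_product continuous_on_add continuous_on_mult
      continuous_on_divide continuous_on_diff continuous_on_const continuous_on_fst continuous_on_id snd
      continuous_on_coordinate continuous_on_weight_faces[OF x sub] continuous_on_total[OF x sub] ballI)
    show "total n x (snd p) \<noteq> 0" if "p \<in> I \<times> T" for p
      using that T by auto
  qed
  then show ?thesis
    by (simp add: case_prod_unfold)
qed

lemma nbhd_slice:
  "x \<in> Simp X n \<Longrightarrow> {t \<in> standard_simplex n. ((n, x), t) \<in> nbhd} = {t \<in> standard_simplex n. 0 < total n x t}"
  by (auto simp: nbhd_iff)

text \<open>The sets on which the support stays inside a fixed face \<open>S\<close> form a finite closed cover, and on each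
of them the face \<open>S\<close> can serve as carrier.\<close>

lemma continuous_map_into_sub:
  assumes x: "x \<in> Simp X n"
  shows "continuous_map (top_of_set {t \<in> standard_simplex n. 0 < total n x t}) (realization A)
    (\<lambda>t. into_sub ((n, x), t))" (is "continuous_map (top_of_set ?D) _ _")
proof (rule pasting_lemma_locally_finite)
  let ?I = "faces n x - {{}}"
  let ?R = "\<lambda>S. {t \<in> ?D. (\<Sum>i\<in>{..n} - S. weight n x t i) = 0}"
  let ?f = "\<lambda>S t. cell_class A ((n, Act X n n (vertex_retract S) x), slide 1 n x t)"
  have "finite ?I"
    using simplicial_complexD(1)[OF simplicial_complex_faces[OF x]] by simp
  then show "\<exists>V. openin (top_of_set ?D) V \<and> t \<in> V \<and> finite {S \<in> ?I. ?R S \<inter> V \<noteq> {}}"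
    if "t \<in> topspace (top_of_set ?D)" for t
    using that openin_topspace by (intro exI[of _ "topspace (top_of_set ?D)"] conjI) auto
  show "closedin (top_of_set ?D) (?R S)" if "S \<in> ?I" for S
    by (intro continuous_closedin_preimage_constant continuous_on_sum continuous_on_weight_faces x) auto
  show "continuous_map (subtopology (top_of_set ?D) (?R S)) (realization A) (?f S)" if "S \<in> ?I" for S
  proof (rule continuous_map_cell_class)
    show "Act X n n (vertex_retract S) x \<in> Simp A n"
      using that by (auto simp: faces_def)
    have "continuous_on ?D (\<lambda>t. slide 1 n x t)"
      by (rule continuous_on_compose2[OF continuous_on_slide[OF x subset_refl, of "{1}"], of ?D "\<lambda>t. (1, t)", simplified])
        (auto intro: continuous_intros)
    then have "continuous_map (top_of_set ?D) (top_of_set (standard_simplex n)) (\<lambda>t. slide 1 n x t)"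
      using slide_closed[of _ n 1 x] by (auto simp: continuous_map_in_subtopology)
    then show "continuous_map (subtopology (top_of_set ?D) (?R S)) (top_of_set (standard_simplex n))
        (\<lambda>t. slide 1 n x t)"
      by (rule continuous_map_from_subtopology)
  qed
  have eq: "into_sub ((n, x), t) = ?f S t" if "S \<in> ?I" "t \<in> ?R S" for S t
  proof -
    have t: "t \<in> standard_simplex n" "0 < total n x t"
      using that by auto
    have sub: "{i. 0 < weight n x t i} \<subseteq> S"
    proof
      fix i assume i: "i \<in> {i. 0 < weight n x t i}"
      have "\<forall>i\<in>{..n} - S. weight n x t i = 0"
        using that(2) weight_nonneg[OF t(1)] by (subst sum_nonneg_eq_0_iff[symmetric]) auto
      moreover have "i \<le> n"
        using i support_weight[OF x t(1)] by (auto simp: faces_def)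
      ultimately show "i \<in> S"
        using i by (metis DiffI atMost_iff less_irrefl mem_Collect_eq)
    qed
    have "slide 1 n x t \<in> standard_simplex n"
      using t by (intro slide_closed) auto
    then show ?thesis
      using cell_class_subface[OF x _ sub support_weight_nonempty[OF t]] that(1) slide_1_support[OF t(1)]
      by (auto simp: into_sub_def)
  qed
  show "?f S t = ?f T t" if "S \<in> ?I" "T \<in> ?I" "t \<in> topspace (top_of_set ?D) \<inter> ?R S \<inter> ?R T" for S T t
    using eq[OF that(1), of t] eq[OF that(2), of t] that(3) by simp
  show "\<exists>S. S \<in> ?I \<and> t \<in> ?R S \<and> into_sub ((n, x), t) = ?f S t" if "t \<in> topspace (top_of_set ?D)" for t
  proof -
    have t: "t \<in> standard_simplex n" "0 < total n x t"
      using that by auto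
    let ?S = "{i. 0 < weight n x t i}"
    have S: "?S \<in> ?I"
      using support_weight[OF x t(1)] support_weight_nonempty[OF t] by blast
    moreover have "(\<Sum>i\<in>{..n} - ?S. weight n x t i) = 0"
      using weight_nonneg[OF t(1), of x] by (intro sum.neutral) (auto simp: order_less_le)
    ultimately show ?thesis
      using t by (intro exI[of _ ?S]) (auto simp: into_sub_def)
  qed
qed

text \<open>The slide respects the gluing because the weights commute with the operators, and it stays in the
closed simplex on which it starts, so that it is continuous cell by cell.\<close>

theorem deformable_neighbourhood:
  obtains W r where "openin (realization X) W"
    and "\<And>n x t. x \<in> Simp A n \<Longrightarrow> t \<in> standard_simplex n \<Longrightarrow> cell_class X ((n, x), t) \<in> W"
    and "continuous_map (subtopology (realization X) W) (realization A) r"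
    and "homotopic_with (\<lambda>_. True) (subtopology (realization X) W) (realization X)
      (\<lambda>c. c) (realization_map X (\<lambda>n x. x) \<circ> r)"
proof -
  let ?Z = "top_of_set {0..1::real}"
  let ?W = "cell_class X ` nbhd"
  have Z: "locally_compact_space ?Z" "Hausdorff_space ?Z"
    by (auto intro!: compact_imp_locally_compact_space Hausdorff_space_subtopology
        simp: compact_space_subtopology)
  have cont: "continuous_map (prod_topology ?Z (top_of_set {t \<in> standard_simplex n. ((n, x), t) \<in> nbhd}))
      (realization X) (\<lambda>(s, t). (\<lambda>(s, ((n, x), t)). cell_class X ((n, x), slide s n x t)) (s, ((n, x), t)))"
    if x: "x \<in> Simp X n" for n x
  proof -
    let ?D = "{t \<in> standard_simplex n. 0 < total n x t}"
    have "continuous_map (top_of_set ({0..1} \<times> ?D)) (top_of_set (standard_simplex n)) (\<lambda>(s, t). slide s n x t)"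
      using continuous_on_slide[OF x subset_refl, of "{0..1}"] slide_closed
      by (auto simp: continuous_map_in_subtopology)
    from continuous_map_cell_class[OF x this] show ?thesis
      by (simp add: nbhd_slice[OF x] prod_topology_subtopology_eu case_prod_unfold)
  qed
  obtain k where k: "continuous_map (prod_topology ?Z (subtopology (realization X) ?W)) (realization X) k"
    and k_eq: "\<And>s p. s \<in> topspace ?Z \<Longrightarrow> p \<in> nbhd
      \<Longrightarrow> k (s, cell_class X p) = (\<lambda>(s, ((n, x), t)). cell_class X ((n, x), slide s n x t)) (s, p)"
  proof (rule realization_descent[OF Z openin_nbhd gluing_nbhd _ cont])
    fix s p q assume s: "s \<in> topspace ?Z" and "gluing X p q" and p: "p \<in> nbhd"
    then show "(\<lambda>(s, ((n, x), t)). cell_class X ((n, x), slide s n x t)) (s, p)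
        = (\<lambda>(s, ((n, x), t)). cell_class X ((n, x), slide s n x t)) (s, q)"
    proof (elim gluing.cases)
      fix \<theta> m n x t
      assume 1: "p = ((m, Act X m n \<theta> x), t)" "q = ((n, x), simplex_push m \<theta> t)"
        "\<theta> \<in> ordinal_maps m n" "x \<in> Simp X n" "t \<in> standard_simplex m"
      have "slide s m (Act X m n \<theta> x) t \<in> standard_simplex m"
        using s p 1 by (intro slide_closed) (auto simp: nbhd_iff)
      then show ?thesis
        using cell_class_push[OF 1(3,4)] slide_push[OF 1(3,4,5)] by (simp add: 1(1,2))
    qed
  qed (assumption | rule that; assumption)+
  obtain l where l: "continuous_map (prod_topology ?Z (subtopology (realization X) ?W)) (realization A) l"
    and l_eq: "\<And>s p. s \<in> topspace ?Z \<Longrightarrow> p \<in> nbhd \<Longrightarrow> l (s, cell_class X p) = (\<lambda>(s, p). into_sub p) (s, p)"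
  proof (rule realization_descent[OF Z openin_nbhd gluing_nbhd])
    show "(\<lambda>(s, p). into_sub p) (s, p) = (\<lambda>(s, p). into_sub p) (s, q)"
      if "s \<in> topspace ?Z" "gluing X p q" "p \<in> nbhd" for s :: real and p q
      using into_sub_gluing that by simp
    show "continuous_map (prod_topology ?Z (top_of_set {t \<in> standard_simplex n. ((n, x), t) \<in> nbhd})) (realization A)
        (\<lambda>(s, t). (\<lambda>(s, p). into_sub p) (s, ((n, x), t)))" if x: "x \<in> Simp X n" for n x
    proof -
      have "continuous_map (prod_topology ?Z (top_of_set {t \<in> standard_simplex n. 0 < total n x t}))
          (realization A) ((\<lambda>t. into_sub ((n, x), t)) \<circ> snd)"
        by (rule continuous_map_compose[OF continuous_map_snd continuous_map_into_sub[OF x]])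
      then show ?thesis
        by (simp add: nbhd_slice[OF x] o_def case_prod_unfold)
    qed
  qed (assumption | rule that; assumption)+
  define r where "r c = l (0, c)" for c
  have r: "continuous_map (subtopology (realization X) ?W) (realization A) r"
    unfolding r_def using continuous_map_o_Pair[OF l, of 0] by (simp add: o_def)
  have inc: "simplicial_map A X (\<lambda>n x. x)"
    using Simp_sub by (auto simp: simplicial_map_def Act_sub)
  have ends: "k (0, cell_class X p) = cell_class X p"
    "k (1, cell_class X p) = realization_map X (\<lambda>n x. x) (r (cell_class X p))" if "p \<in> nbhd" for p
  proof -
    obtain n x t where p: "p = ((n, x), t)"
      by (metis surj_pair)
    have x: "x \<in> Simp X n" and t: "t \<in> standard_simplex n" "0 < total n x t"
      using that p by (auto simp: nbhd_iff)
    have "slide 0 n x t = t"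
      by (simp add: slide_def fun_eq_iff)
    then show "k (0, cell_class X p) = cell_class X p"
      using k_eq[of 0 p] that p by simp
    let ?S = "{i. 0 < weight n x t i}"
    have S: "?S \<in> faces n x" "?S \<noteq> {}"
      using support_weight[OF x t(1)] support_weight_nonempty[OF t] .
    then have A: "?S \<subseteq> {..n}" "Act X n n (vertex_retract ?S) x \<in> Simp A n"
      by (auto simp: faces_def)
    have w: "slide 1 n x t \<in> standard_simplex n"
      using t by (intro slide_closed) auto
    have "realization_map X (\<lambda>n x. x) (r (cell_class X p))
        = cell_class X ((n, Act X n n (vertex_retract ?S) x), slide 1 n x t)"
      using l_eq[of 0 p] that realization_map_cell_class[OF inc A(2) w] by (simp add: r_def p into_sub_def)
    also have "\<dots> = cell_class X ((n, x), simplex_push n (vertex_retract ?S) (slide 1 n x t))"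
      by (rule cell_class_push[OF retract_ordinal_maps[OF A(1) S(2)] x w])
    also have "simplex_push n (vertex_retract ?S) (slide 1 n x t) = slide 1 n x t"
      by (rule simplex_push_retract[OF slide_1_support[OF t(1)] A(1) S(2)])
    also have "cell_class X ((n, x), slide 1 n x t) = k (1, cell_class X p)"
      using k_eq[of 1 p] that p by simp
    finally show "k (1, cell_class X p) = realization_map X (\<lambda>n x. x) (r (cell_class X p))"
      by simp
  qed
  have "homotopic_with (\<lambda>_. True) (subtopology (realization X) ?W) (realization X)
      (\<lambda>c. c) (realization_map X (\<lambda>n x. x) \<circ> r)"
    by (subst homotopic_with) (use k ends in \<open>auto intro!: exI[of _ k]\<close>)
  moreover have "cell_class X ((n, x), t) \<in> ?W" if x: "x \<in> Simp A n" and t: "t \<in> standard_simplex n" for n x t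
  proof -
    have xX: "x \<in> Simp X n"
      using x Simp_sub by blast
    have "{..n} \<in> faces n x"
      using sub.Act_closed[OF retract_ordinal_maps[of "{..n}" n n] x] by (auto simp: faces_def Act_sub)
    then have "weight n x t i = t i" if "i \<le> n" for i
      using retention_full[OF simplicial_complex_faces[OF xX] _ that] by (simp add: weight_def)
    then have "total n x t = 1"
      using standard_simplexD(3)[OF t] by (simp add: total_def)
    then show ?thesis
      using xX t by (auto simp: nbhd_iff)
  qed
  ultimately show thesis
    using that openin_realization[OF openin_nbhd gluing_nbhd] r by blast
qed

end

section \<open>Simplicial homotopies\<close>

text \<open>A point of a simplex corresponds to a step function from \<open>[0,1]\<close> to the vertices, and \<open>cum t c\<close> is
the time at which it reaches vertex \<open>c\<close>. In these terms operators act by composition, and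
identities between barycentric coordinates reduce to identities between jump times.\<close>

definition cum :: "(nat \<Rightarrow> real) \<Rightarrow> nat \<Rightarrow> real" where
  "cum t c = sum t {..<c}"

text \<open>The point \<open>(s, t)\<close> of the prism pairs the step function of \<open>t\<close> with the one that jumps from level \<open>0\<close> to
level \<open>1\<close> at time \<open>1 - s\<close>. If that jump happens while the first function is at vertex \<open>k\<close>, the pair
runs through the chain \<open>(0,0), \<dots>, (k,0), (k,1), \<dots>, (n,1)\<close>, and these are its jump times.\<close>

definition prism_cum :: "nat \<Rightarrow> real \<Rightarrow> (nat \<Rightarrow> real) \<Rightarrow> nat \<Rightarrow> real" where
  "prism_cum k s t c = (if c \<le> k then cum t c else if c = Suc k then 1 - s else cum t (c - 1))"

definition prism_weight :: "nat \<Rightarrow> real \<Rightarrow> (nat \<Rightarrow> real) \<Rightarrow> nat \<Rightarrow> real" where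
  "prism_weight k s t i = prism_cum k s t (Suc i) - prism_cum k s t i"

definition prism_region :: "nat \<Rightarrow> real \<Rightarrow> (nat \<Rightarrow> real) \<Rightarrow> bool" where
  "prism_region k s t \<longleftrightarrow> cum t k \<le> 1 - s \<and> 1 - s \<le> cum t (Suc k)"

text \<open>\<open>collapse k\<close> and \<open>level k\<close> are the two coordinates of the chain
\<open>(0,0), \<dots>, (k,0), (k,1), \<dots>, (n,1)\<close> in \<open>[n] \<times> [1]\<close>.\<close>

definition collapse :: "nat \<Rightarrow> nat \<Rightarrow> nat" where
  "collapse k i = (if i \<le> k then i else i - 1)"

definition level :: "nat \<Rightarrow> nat \<Rightarrow> nat" where
  "level k i = (if i \<le> k then 0 else 1)"

lemma collapse_ordinal: "k \<le> n \<Longrightarrow> collapse k \<in> ordinal_maps (Suc n) n"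
  by (intro ordinal_mapsI) (auto simp: collapse_def)

lemma level_ordinal: "level k \<in> ordinal_maps n 1"
  by (intro ordinal_mapsI) (auto simp: level_def)

lemma cum_prism_weight: "cum (prism_weight k s t) c = prism_cum k s t c"
proof -
  have "cum (prism_weight k s t) c = prism_cum k s t c - prism_cum k s t 0"
    unfolding cum_def prism_weight_def by (rule sum_lessThan_telescope)
  then show ?thesis
    by (simp add: prism_cum_def cum_def)
qed

lemma cum_inject: "(\<And>c. cum t c = cum u c) \<Longrightarrow> t = u"
proof
  fix i assume *: "\<And>c. cum t c = cum u c"
  have "t i = cum t (Suc i) - cum t i" "u i = cum u (Suc i) - cum u i"
    by (simp_all add: cum_def)
  then show "t i = u i"
    using * by simp
qed

lemma cum_mono: "(\<And>i. 0 \<le> t i) \<Longrightarrow> c \<le> d \<Longrightarrow> cum t c \<le> cum t d"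
  unfolding cum_def by (intro sum_mono2) auto

lemma cum_simplex:
  assumes "t \<in> standard_simplex n" and "n < c"
  shows "cum t c = 1"
proof -
  have "cum t c = sum t {..n}"
    unfolding cum_def using assms standard_simplexD(2)[OF assms(1)]
    by (intro sum.mono_neutral_right) auto
  then show ?thesis
    using standard_simplexD(3)[OF assms(1)] by simp
qed

text \<open>A monotone \<open>\<theta>\<close> maps exactly an initial segment \<open>{..<d}\<close> below \<open>c\<close>.\<close>

lemma cum_simplex_push:
  assumes "\<And>i. i \<le> m \<Longrightarrow> \<theta> i < c \<longleftrightarrow> i < d" and "t \<in> standard_simplex m"
  shows "cum (simplex_push m \<theta> t) c = cum t d"
proof -
  have "cum (simplex_push m \<theta> t) c = sum t {i. i \<le> m \<and> \<theta> i \<in> {..<c}}"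
    unfolding cum_def by (rule sum_simplex_push) simp
  also have "\<dots> = sum t {i. i \<le> m \<and> i < d}"
    using assms(1) by (intro arg_cong[of _ _ "sum t"]) auto
  also have "\<dots> = cum t d"
  proof -
    have "t i = 0" if "\<not> i \<le> m" for i
      using standard_simplexD(2)[OF assms(2)] that by simp
    then show ?thesis
      unfolding cum_def by (intro sum.mono_neutral_left) auto
  qed
  finally show ?thesis .
qed

lemma prism_weight_closed:
  assumes t: "t \<in> standard_simplex n" and k: "k \<le> n" and region: "prism_region k s t"
  shows "prism_weight k s t \<in> standard_simplex (Suc n)"
proof (rule standard_simplexI)
  have mono: "cum t c \<le> cum t d" if "c \<le> d" for c d
    using cum_mono[OF standard_simplexD(1)[OF t] that] .
  show "0 \<le> prism_weight k s t i" for i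
    using region mono[of i "Suc i"] mono[of "i - 1" i]
    by (auto simp: prism_weight_def prism_cum_def prism_region_def le_Suc_eq)
  show "prism_weight k s t i = 0" if "i > Suc n" for i
    using that k cum_simplex[OF t] by (simp add: prism_weight_def prism_cum_def)
  have "(\<Sum>i\<le>Suc n. prism_weight k s t i) = prism_cum k s t (Suc (Suc n))"
    using cum_prism_weight[of k s t "Suc (Suc n)"] by (simp add: cum_def lessThan_Suc_atMost)
  then show "(\<Sum>i\<le>Suc n. prism_weight k s t i) = 1"
    using k cum_simplex[OF t, of "Suc n"] by (simp add: prism_cum_def)
qed

lemma prism_weight_eq_push:
  assumes t: "t \<in> standard_simplex n"
    and eq: "\<And>c. prism_cum k s t c = cum t (d c)"
    and d: "\<And>c i. i \<le> n \<Longrightarrow> \<delta> i < c \<longleftrightarrow> i < d c"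
  shows "prism_weight k s t = simplex_push n \<delta> t"
  by (rule cum_inject) (simp add: cum_prism_weight eq cum_simplex_push[OF d t])

lemma ex_prism_region:
  assumes t: "t \<in> standard_simplex n" and s: "s \<in> {0..1}"
  shows "\<exists>k\<le>n. prism_region k s t"
proof -
  define k where "k = (LEAST k. 1 - s \<le> cum t (Suc k))"
  have n: "1 - s \<le> cum t (Suc n)"
    using cum_simplex[OF t, of "Suc n"] s by simp
  have upper: "1 - s \<le> cum t (Suc k)"
    unfolding k_def using n by (rule LeastI)
  have "k \<le> n"
    unfolding k_def using n by (rule Least_le)
  moreover have "cum t k \<le> 1 - s"
  proof (cases k)
    case 0
    then show ?thesis using s by (simp add: cum_def)
  next
    case (Suc j)
    then have "\<not> 1 - s \<le> cum t (Suc j)"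
      using not_less_Least[of j "\<lambda>k. 1 - s \<le> cum t (Suc k)"] by (simp add: k_def)
    then show ?thesis
      using Suc by simp
  qed
  ultimately show ?thesis
    using upper by (auto simp: prism_region_def)
qed

text \<open>A simplicial map \<open>X \<times> \<Delta>\<^sup>1 \<rightarrow> Y\<close>, with an \<open>n\<close>-simplex of \<open>\<Delta>\<^sup>1\<close> given as a monotone map \<open>q : [n] \<rightarrow> [1]\<close>.\<close>

locale simplicial_homotopy = X: simplicial_set X + Y: simplicial_set Y
  for X :: "'x sset" and Y :: "'y sset" +
  fixes H :: "nat \<Rightarrow> 'x \<Rightarrow> (nat \<Rightarrow> nat) \<Rightarrow> 'y"
  assumes H_closed: "x \<in> Simp X n \<Longrightarrow> q \<in> ordinal_maps n 1 \<Longrightarrow> H n x q \<in> Simp Y n"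
    and Act_H: "\<theta> \<in> ordinal_maps m n \<Longrightarrow> x \<in> Simp X n \<Longrightarrow> q \<in> ordinal_maps n 1
      \<Longrightarrow> Act Y m n \<theta> (H n x q) = H m (Act X m n \<theta> x) (q \<circ> \<theta>)"
    and H_cong: "x \<in> Simp X n \<Longrightarrow> (\<And>i. i \<le> n \<Longrightarrow> q i = q' i) \<Longrightarrow> H n x q = H n x q'"
begin

definition prism_simplex :: "nat \<Rightarrow> 'x \<Rightarrow> nat \<Rightarrow> 'y" where
  "prism_simplex n x k = H (Suc n) (Act X (Suc n) n (collapse k) x) (level k)"

definition prism_point :: "nat \<Rightarrow> 'x \<Rightarrow> nat \<Rightarrow> real \<Rightarrow> (nat \<Rightarrow> real) \<Rightarrow> 'y cell_point set" where
  "prism_point n x k s t = cell_class Y ((Suc n, prism_simplex n x k), prism_weight k s t)"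

lemma prism_simplex_closed:
  assumes "x \<in> Simp X n" and "k \<le> n"
  shows "prism_simplex n x k \<in> Simp Y (Suc n)"
  unfolding prism_simplex_def
  using assms by (intro H_closed X.Act_closed collapse_ordinal level_ordinal)

lemma Act_prism_simplex:
  assumes x: "x \<in> Simp X n" and k: "k \<le> n" and \<delta>: "\<delta> \<in> ordinal_maps m (Suc n)"
  shows "Act Y m (Suc n) \<delta> (prism_simplex n x k) = H m (Act X m n (collapse k \<circ> \<delta>) x) (level k \<circ> \<delta>)"
  unfolding prism_simplex_def
  using Act_H[OF \<delta> X.Act_closed[OF collapse_ordinal[OF k] x] level_ordinal]
    X.Act_Act[OF \<delta> collapse_ordinal[OF k] x] by simp

text \<open>A point of the prism simplex on a face that projects isomorphically to \<open>[n]\<close>, with inclusion \<open>\<delta>\<close>, can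
be read off from the \<open>n\<close>-simplex \<open>x\<close>. The ends and the inner walls of the prism are of this kind.\<close>

lemma prism_point_section:
  assumes x: "x \<in> Simp X n" and k: "k \<le> n" and t: "t \<in> standard_simplex n"
    and \<delta>: "\<delta> \<in> ordinal_maps n (Suc n)" and w: "prism_weight k s t = simplex_push n \<delta> t"
    and sec: "\<And>i. i \<le> n \<Longrightarrow> collapse k (\<delta> i) = i"
    and q: "\<And>i. i \<le> n \<Longrightarrow> level k (\<delta> i) = q i"
  shows "prism_point n x k s t = cell_class Y ((n, H n x q), t)"
proof -
  have "Act X n n (collapse k \<circ> \<delta>) x = Act X n n (\<lambda>i. i) x"
    using x sec by (intro X.Act_cong) auto
  then have "Act Y n (Suc n) \<delta> (prism_simplex n x k) = H n x (level k \<circ> \<delta>)"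
    using Act_prism_simplex[OF x k \<delta>] X.Act_id[OF x] by simp
  also have "\<dots> = H n x q"
    using x q by (intro H_cong) auto
  finally show ?thesis
    unfolding prism_point_def w
    using Y.cell_class_push[OF \<delta> prism_simplex_closed[OF x k] t] by simp
qed

lemma prism_point_start:
  assumes x: "x \<in> Simp X n" and t: "t \<in> standard_simplex n"
  shows "prism_region n 0 t" and "prism_point n x n 0 t = cell_class Y ((n, H n x (\<lambda>_. 0)), t)"
proof -
  have mono: "cum t n \<le> cum t (Suc n)"
    using cum_mono[OF standard_simplexD(1)[OF t]] by simp
  then show "prism_region n 0 t"
    using cum_simplex[OF t, of "Suc n"] by (simp add: prism_region_def)
  show "prism_point n x n 0 t = cell_class Y ((n, H n x (\<lambda>_. 0)), t)"
  proof (rule prism_point_section[OF x order_refl t])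
    show "(\<lambda>i. i) \<in> ordinal_maps n (Suc n)"
      by (rule ordinal_mapsI) auto
    show "prism_weight n 0 t = simplex_push n (\<lambda>i. i) t"
      by (rule prism_weight_eq_push[OF t, where d = "\<lambda>c. c"])
        (use cum_simplex[OF t] in \<open>auto simp: prism_cum_def\<close>)
  qed (auto simp: collapse_def level_def)
qed

lemma prism_point_end:
  assumes x: "x \<in> Simp X n" and t: "t \<in> standard_simplex n"
  shows "prism_region 0 1 t" and "prism_point n x 0 1 t = cell_class Y ((n, H n x (\<lambda>_. 1)), t)"
proof -
  show "prism_region 0 1 t"
    using standard_simplexD(1)[OF t] by (simp add: prism_region_def cum_def)
  show "prism_point n x 0 1 t = cell_class Y ((n, H n x (\<lambda>_. 1)), t)"
  proof (rule prism_point_section[OF x le0 t])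
    show "Suc \<in> ordinal_maps n (Suc n)"
      by (rule ordinal_mapsI) auto
    show "prism_weight 0 1 t = simplex_push n Suc t"
      by (rule prism_weight_eq_push[OF t, where d = "\<lambda>c. c - 1"])
        (auto simp: prism_cum_def cum_def)
  qed (auto simp: collapse_def level_def)
qed

text \<open>On the common wall both prism simplices have the same face, which omits vertex \<open>k + 1\<close> of either chain.\<close>

lemma prism_point_adjacent:
  assumes x: "x \<in> Simp X n" and t: "t \<in> standard_simplex n" and k: "Suc k \<le> n"
    and "prism_region k s t" and "prism_region (Suc k) s t"
  shows "prism_point n x k s t = prism_point n x (Suc k) s t"
proof -
  have s: "1 - s = cum t (Suc k)"
    using assms(4,5) by (auto simp: prism_region_def)
  let ?\<delta> = "\<lambda>i. if i \<le> k then i else Suc i"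
  let ?d = "\<lambda>c. if c \<le> Suc k then c else c - 1"
  have \<delta>: "?\<delta> \<in> ordinal_maps n (Suc n)"
    by (rule ordinal_mapsI) auto
  have d: "?\<delta> i < c \<longleftrightarrow> i < ?d c" for i c
    by auto
  have "prism_weight k s t = simplex_push n ?\<delta> t"
    by (rule prism_weight_eq_push[OF t _ d]) (use s in \<open>auto simp: prism_cum_def\<close>)
  then have "prism_point n x k s t = cell_class Y ((n, H n x (level k)), t)"
    using k by (intro prism_point_section[OF x _ t \<delta>]) (auto simp: collapse_def level_def)
  moreover have "prism_weight (Suc k) s t = simplex_push n ?\<delta> t"
    by (rule prism_weight_eq_push[OF t _ d]) (use s in \<open>auto simp: prism_cum_def\<close>)
  then have "prism_point n x (Suc k) s t = cell_class Y ((n, H n x (level k)), t)"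
    by (intro prism_point_section[OF x k t \<delta>]) (auto simp: collapse_def level_def)
  ultimately show ?thesis by simp
qed

lemma prism_point_unique:
  assumes x: "x \<in> Simp X n" and t: "t \<in> standard_simplex n" and "k \<le> l" and "l \<le> n"
    and k: "prism_region k s t" and l: "prism_region l s t"
  shows "prism_point n x k s t = prism_point n x l s t"
proof -
  have mono: "cum t c \<le> cum t d" if "c \<le> d" for c d
    using cum_mono[OF standard_simplexD(1)[OF t] that] .
  have region: "prism_region j s t" if "k \<le> j" "j \<le> l" for j
    using k l mono[OF that(2)] mono[of "Suc k" "Suc j"] that(1) by (auto simp: prism_region_def)
  have "prism_point n x k s t = prism_point n x j s t" if "k \<le> j" "j \<le> l" for j
    using that
  proof (induction j rule: dec_induct)
    case (step j)
    then show ?case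
      using prism_point_adjacent[OF x t, of j s] region[of j] region[of "Suc j"] assms(4) by simp
  qed simp
  then show ?thesis
    using assms(3) by simp
qed

text \<open>An operator \<open>\<theta> : [m] \<rightarrow> [n]\<close> carries the \<open>k\<close>-th prism over \<open>[m]\<close> to the \<open>\<theta> k\<close>-th prism over \<open>[n]\<close>; on the
chains it is the operator \<open>\<theta>'\<close> that acts as \<open>\<theta>\<close> on both levels.\<close>

lemma prism_point_Act:
  assumes \<theta>: "\<theta> \<in> ordinal_maps m n" and x: "x \<in> Simp X n" and t: "t \<in> standard_simplex m"
    and k: "k \<le> m" and region: "prism_region k s t"
  shows "prism_region (\<theta> k) s (simplex_push m \<theta> t)"
    and "prism_point m (Act X m n \<theta> x) k s t = prism_point n x (\<theta> k) s (simplex_push m \<theta> t)"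
proof -
  let ?u = "simplex_push m \<theta> t"
  have u: "?u \<in> standard_simplex n"
    using \<theta> t by (rule simplex_push_closed)
  have mono: "cum t c \<le> cum t d" if "c \<le> d" for c d
    using cum_mono[OF standard_simplexD(1)[OF t] that] .
  have \<theta>_mono: "\<theta> i \<le> \<theta> j" if "i \<le> j" "j \<le> m" for i j
    using ordinal_maps_mono[OF \<theta> that] .
  \<comment> \<open>The initial segment of \<open>[m]\<close> that \<open>\<theta>\<close> maps below \<open>c\<close> is \<open>{..<d c}\<close>.\<close>
  define d where "d c = (LEAST i. m < i \<or> c \<le> \<theta> i)" for c
  have d: "\<theta> i < c \<longleftrightarrow> i < d c" if "i \<le> m" for i c
  proof
    assume "\<theta> i < c"
    have "m < d c \<or> c \<le> \<theta> (d c)"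
      unfolding d_def by (rule LeastI[of _ "Suc m"]) simp
    then show "i < d c"
      using \<open>\<theta> i < c\<close> that \<theta>_mono[of "d c" i] by (metis le_trans not_le order_less_le_trans)
  next
    assume "i < d c"
    then show "\<theta> i < c"
      using not_less_Least[of i "\<lambda>i. m < i \<or> c \<le> \<theta> i"] by (simp add: d_def)
  qed
  have cum_u: "cum ?u c = cum t (d c)" for c
    by (rule cum_simplex_push[OF d t])
  have d_le: "d c \<le> Suc m" for c
    unfolding d_def by (rule Least_le) simp
  have d_low: "d c \<le> k" if "c \<le> \<theta> k" for c
    using d[of k c] k that by auto
  have d_high: "Suc k \<le> d c" if "\<theta> k < c" for c
    using d[of k c] k that by auto
  show r: "prism_region (\<theta> k) s ?u"
    using region mono[OF d_low[OF order_refl]] mono[OF d_high[OF lessI]] cum_u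
    by (auto simp: prism_region_def)
  define \<theta>' where "\<theta>' i = (if i \<le> k then \<theta> i else Suc (\<theta> (i - 1)))" for i
  have \<theta>': "\<theta>' \<in> ordinal_maps (Suc m) (Suc n)"
  proof (rule ordinal_mapsI)
    show "\<theta>' i \<le> Suc n" if "i \<le> Suc m" for i
      using that k ordinal_maps_le[OF \<theta>, of i] ordinal_maps_le[OF \<theta>, of "i - 1"]
      by (auto simp: \<theta>'_def)
    show "\<theta>' i \<le> \<theta>' j" if "i \<le> j" "j \<le> Suc m" for i j
    proof -
      have "\<theta> i \<le> \<theta> (j - 1)" if "i \<le> k" "k < j"
        using that \<open>j \<le> Suc m\<close> by (intro \<theta>_mono) auto
      moreover have "\<theta> (i - 1) \<le> \<theta> (j - 1)"
        using that by (intro \<theta>_mono) auto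
      moreover have "\<theta> i \<le> \<theta> j" if "j \<le> k"
        using \<open>i \<le> j\<close> that k by (intro \<theta>_mono) auto
      ultimately show ?thesis
        using \<open>i \<le> j\<close> by (auto simp: \<theta>'_def intro: le_SucI)
    qed
  qed
  have \<theta>k: "\<theta> k \<le> n"
    using ordinal_maps_le[OF \<theta> k] .
  have low: "\<theta>' i \<le> \<theta> k \<longleftrightarrow> i \<le> k" if "i \<le> Suc m" for i
  proof (cases "i \<le> k")
    case True
    then show ?thesis
      using k \<theta>_mono[of i k] by (simp add: \<theta>'_def)
  next
    case False
    then have "\<theta> k \<le> \<theta> (i - 1)"
      using that by (intro \<theta>_mono) auto
    then show ?thesis
      using False by (simp add: \<theta>'_def)
  qed
  have simplex: "Act Y (Suc m) (Suc n) \<theta>' (prism_simplex n x (\<theta> k)) = prism_simplex m (Act X m n \<theta> x) k"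
  proof -
    have "Act Y (Suc m) (Suc n) \<theta>' (prism_simplex n x (\<theta> k))
        = H (Suc m) (Act X (Suc m) n (collapse (\<theta> k) \<circ> \<theta>') x) (level (\<theta> k) \<circ> \<theta>')"
      by (rule Act_prism_simplex[OF x \<theta>k \<theta>'])
    also have "Act X (Suc m) n (collapse (\<theta> k) \<circ> \<theta>') x = Act X (Suc m) n (\<theta> \<circ> collapse k) x"
      using x low by (intro X.Act_cong) (auto simp: collapse_def \<theta>'_def)
    also have "\<dots> = Act X (Suc m) m (collapse k) (Act X m n \<theta> x)"
      by (rule X.Act_Act[OF collapse_ordinal[OF k] \<theta> x, symmetric])
    also have "H (Suc m) \<dots> (level (\<theta> k) \<circ> \<theta>') = H (Suc m) \<dots> (level k)"
      using low by (intro H_cong X.Act_closed[OF collapse_ordinal[OF k]] X.Act_closed[OF \<theta> x])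
        (auto simp: level_def)
    finally show ?thesis
      by (simp add: prism_simplex_def)
  qed
  have w: "prism_weight k s t \<in> standard_simplex (Suc m)"
    by (rule prism_weight_closed[OF t k region])
  have "cum (simplex_push (Suc m) \<theta>' (prism_weight k s t)) c = cum (prism_weight (\<theta> k) s ?u) c" for c
  proof -
    \<comment> \<open>Likewise \<open>{..<e}\<close> is the initial segment that \<open>\<theta>'\<close> maps below \<open>c\<close>.\<close>
    define e where "e = (if c \<le> \<theta> k then d c else if c = Suc (\<theta> k) then Suc k else Suc (d (c - 1)))"
    have "\<theta>' i < c \<longleftrightarrow> i < e" if i: "i \<le> Suc m" for i
    proof (cases "c \<le> \<theta> k")
      case True
      then show ?thesis
        using d[of i c] d_low[OF True] low[OF i] i k by (auto simp: e_def \<theta>'_def)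
    next
      case False
      show ?thesis
      proof (cases "c = Suc (\<theta> k)")
        case True
        then show ?thesis
          using low[OF i] by (auto simp: e_def)
      next
        case neq: False
        have high: "Suc k \<le> d (c - 1)"
          using False neq by (intro d_high) simp
        show ?thesis
        proof (cases "i \<le> k")
          case True
          then have "\<theta>' i \<le> \<theta> k"
            using low[OF i] by simp
          then show ?thesis
            using False neq high True by (auto simp: e_def)
        next
          case iF: False
          have "\<theta> (i - 1) < c - 1 \<longleftrightarrow> i - 1 < d (c - 1)"
            using i by (intro d) simp
          then show ?thesis
            using False neq iF by (auto simp: e_def \<theta>'_def)
        qed
      qed
    qed
    then have "cum (simplex_push (Suc m) \<theta>' (prism_weight k s t)) c = prism_cum k s t e"
      using cum_simplex_push[OF _ w, of \<theta>' c e] cum_prism_weight by simp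
    also have "\<dots> = prism_cum (\<theta> k) s ?u c"
    proof -
      have "Suc k \<le> d (c - 1)" if "\<not> c \<le> \<theta> k" "c \<noteq> Suc (\<theta> k)"
        using that by (intro d_high) simp
      then show ?thesis
        using d_low[of c] by (auto simp: prism_cum_def e_def cum_u)
    qed
    finally show ?thesis
      by (simp add: cum_prism_weight)
  qed
  then have push: "simplex_push (Suc m) \<theta>' (prism_weight k s t) = prism_weight (\<theta> k) s ?u"
    by (rule cum_inject)
  show "prism_point m (Act X m n \<theta> x) k s t = prism_point n x (\<theta> k) s ?u"
    unfolding prism_point_def simplex[symmetric] push[symmetric]
    by (rule Y.cell_class_push[OF \<theta>' prism_simplex_closed[OF x \<theta>k] w])
qed

definition prism_map :: "real \<times> 'x cell_point \<Rightarrow> 'y cell_point set" where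
  "prism_map = (\<lambda>(s, ((n, x), t)). prism_point n x (SOME k. k \<le> n \<and> prism_region k s t) s t)"

lemma prism_map_eq:
  assumes "x \<in> Simp X n" and "t \<in> standard_simplex n" and "k \<le> n" and "prism_region k s t"
  shows "prism_map (s, ((n, x), t)) = prism_point n x k s t"
proof -
  let ?l = "SOME k. k \<le> n \<and> prism_region k s t"
  have l: "?l \<le> n" "prism_region ?l s t"
    using someI[of "\<lambda>k. k \<le> n \<and> prism_region k s t" k] assms(3,4) by blast+
  have "prism_point n x ?l s t = prism_point n x k s t"
  proof (cases "k \<le> ?l")
    case True
    show ?thesis
      by (rule prism_point_unique[OF assms(1,2) True l(1) assms(4) l(2), symmetric])
  next
    case False
    then have "?l \<le> k" by simp
    show ?thesis
      by (rule prism_point_unique[OF assms(1,2) \<open>?l \<le> k\<close> assms(3) l(2) assms(4)])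
  qed
  then show ?thesis
    by (simp add: prism_map_def)
qed

lemma prism_map_gluing:
  assumes "s \<in> {0..1}" and "gluing X p q"
  shows "prism_map (s, p) = prism_map (s, q)"
  using assms(2)
proof cases
  case (1 \<theta> m n x t)
  obtain k where k: "k \<le> m" "prism_region k s t"
    using ex_prism_region[OF 1(5) assms(1)] by blast
  show ?thesis
    using prism_map_eq[OF X.Act_closed[OF 1(3,4)] 1(5) k] prism_point_Act[OF 1(3,4,5) k]
      prism_map_eq[OF 1(4) simplex_push_closed[OF 1(3,5)] ordinal_maps_le[OF 1(3) k(1)]]
    by (simp add: 1(1,2))
qed

lemma continuous_on_cum: "continuous_on S (\<lambda>p. cum (snd p) c)"
  unfolding cum_def
  by (intro continuous_on_sum continuous_on_compose2[OF continuous_on_coordinate[of UNIV] continuous_on_snd[OF continuous_on_id]]) auto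

lemma continuous_map_prism_map:
  assumes x: "x \<in> Simp X n"
  shows "continuous_map (top_of_set ({0..1} \<times> standard_simplex n)) (realization Y)
    (\<lambda>(s, t). prism_map (s, ((n, x), t)))" (is "continuous_map (top_of_set ?D) _ _")
proof (rule pasting_lemma_locally_finite)
  let ?R = "\<lambda>k. {p \<in> ?D. prism_region k (fst p) (snd p)}"
  let ?f = "\<lambda>k p. prism_point n x k (fst p) (snd p)"
  show "\<exists>V. openin (top_of_set ?D) V \<and> p \<in> V \<and> finite {k \<in> {..n}. ?R k \<inter> V \<noteq> {}}"
    if "p \<in> topspace (top_of_set ?D)" for p
    using that openin_topspace by (intro exI[of _ "topspace (top_of_set ?D)"] conjI) auto
  show "closedin (top_of_set ?D) (?R k)" if "k \<in> {..n}" for k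
  proof -
    have "closed {p::real \<times> (nat \<Rightarrow> real). cum (snd p) k \<le> 1 - fst p \<and> 1 - fst p \<le> cum (snd p) (Suc k)}"
      by (intro closed_Collect_conj closed_Collect_le continuous_on_cum continuous_intros)
    then have "closedin (top_of_set ?D) (?D \<inter> {p. prism_region k (fst p) (snd p)})"
      unfolding prism_region_def by (rule closedin_closed_Int)
    then show ?thesis
      by (simp add: Int_def)
  qed
  show "continuous_map (subtopology (top_of_set ?D) (?R k)) (realization Y) (?f k)" if k: "k \<in> {..n}" for k
    unfolding prism_point_def
  proof (rule continuous_map_cell_class)
    show "prism_simplex n x k \<in> Simp Y (Suc n)"
      using x k by (intro prism_simplex_closed) auto
    have cont: "continuous_on S (\<lambda>p::real \<times> (nat \<Rightarrow> real). prism_cum k (fst p) (snd p) c)" for S c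
      unfolding prism_cum_def
      by (cases "c \<le> k"; cases "c = Suc k") (auto intro!: continuous_intros continuous_on_cum)
    have "continuous_on (?R k) (\<lambda>p. prism_weight k (fst p) (snd p))"
      unfolding prism_weight_def
      by (intro continuous_on_coordinatewise_then_product continuous_on_diff cont)
    moreover have "prism_weight k (fst p) (snd p) \<in> standard_simplex (Suc n)" if "p \<in> ?R k" for p
      using that k by (intro prism_weight_closed) auto
    moreover have "?D \<inter> ?R k = ?R k" by blast
    ultimately show "continuous_map (subtopology (top_of_set ?D) (?R k)) (top_of_set (standard_simplex (Suc n)))
        (\<lambda>p. prism_weight k (fst p) (snd p))"
      by (simp add: subtopology_subtopology continuous_map_in_subtopology image_subset_iff)
  qed
  have eq: "(\<lambda>(s, t). prism_map (s, ((n, x), t))) p = ?f k p" if "k \<in> {..n}" "p \<in> ?R k" for k p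
    using prism_map_eq[OF x, of "snd p" k "fst p"] that by (auto simp: case_prod_unfold)
  show "?f k p = ?f l p" if "k \<in> {..n}" "l \<in> {..n}" "p \<in> topspace (top_of_set ?D) \<inter> ?R k \<inter> ?R l" for k l p
    using eq[OF that(1), of p] eq[OF that(2), of p] that(3) by simp
  show "\<exists>k. k \<in> {..n} \<and> p \<in> ?R k \<and> (\<lambda>(s, t). prism_map (s, ((n, x), t))) p = ?f k p"
    if p: "p \<in> topspace (top_of_set ?D)" for p
  proof -
    have "fst p \<in> {0..1}" "snd p \<in> standard_simplex n"
      using p by auto
    then obtain k where "k \<le> n" "prism_region k (fst p) (snd p)"
      using ex_prism_region by blast
    then have "k \<in> {..n}" "p \<in> ?R k"
      using p by auto
    then show ?thesis
      using eq[of k p] by (intro exI[of _ k] conjI)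
  qed
qed

theorem homotopic_realization_maps:
  "homotopic_with (\<lambda>_. True) (realization X) (realization Y)
    (realization_map Y (\<lambda>n x. H n x (\<lambda>_. 0))) (realization_map Y (\<lambda>n x. H n x (\<lambda>_. 1)))"
proof -
  let ?Z = "top_of_set {0..1::real}"
  let ?T = "topspace (cell_space X)"
  have Z: "locally_compact_space ?Z" "Hausdorff_space ?Z"
    by (auto intro!: compact_imp_locally_compact_space Hausdorff_space_subtopology
        simp: compact_space_subtopology)
  have sat: "p \<in> ?T \<longleftrightarrow> q \<in> ?T" if "gluing X p q" for p q
    using that by cases (auto simp: topspace_cell_space X.Act_closed simplex_push_closed)
  have slice: "{t \<in> standard_simplex n. ((n, x), t) \<in> ?T} = standard_simplex n" if "x \<in> Simp X n" for n x
    using that by (auto simp: topspace_cell_space)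
  obtain k where k: "continuous_map (prod_topology ?Z (subtopology (realization X) (cell_class X ` ?T))) (realization Y) k"
    and k_eq: "\<And>s p. s \<in> topspace ?Z \<Longrightarrow> p \<in> ?T \<Longrightarrow> k (s, cell_class X p) = prism_map (s, p)"
  proof (rule realization_descent[OF Z openin_topspace sat])
    show "prism_map (s, p) = prism_map (s, q)" if "s \<in> topspace ?Z" "gluing X p q" for s p q
      using that by (intro prism_map_gluing) auto
    show "continuous_map (prod_topology ?Z (top_of_set {t \<in> standard_simplex n. ((n, x), t) \<in> ?T})) (realization Y)
        (\<lambda>(s, t). prism_map (s, ((n, x), t)))" if "x \<in> Simp X n" for n x
      using continuous_map_prism_map[OF that] by (simp add: slice[OF that] prod_topology_subtopology_eu)
  qed (assumption | rule that; assumption)+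
  have e: "simplicial_map X Y (\<lambda>n x. H n x (\<lambda>_. e))" if "e \<le> 1" for e
  proof -
    have "(\<lambda>_. e) \<in> ordinal_maps n 1" for n
      using that by (intro ordinal_mapsI) auto
    then show ?thesis
      using H_closed Act_H by (auto simp: simplicial_map_def o_def)
  qed
  have ends: "k (0, cell_class X p) = realization_map Y (\<lambda>n x. H n x (\<lambda>_. 0)) (cell_class X p)"
    "k (1, cell_class X p) = realization_map Y (\<lambda>n x. H n x (\<lambda>_. 1)) (cell_class X p)" if "p \<in> ?T" for p
  proof -
    obtain n x t where p: "p = ((n, x), t)"
      by (metis surj_pair)
    have x: "x \<in> Simp X n" and t: "t \<in> standard_simplex n"
      using that by (auto simp: p topspace_cell_space)
    show "k (0, cell_class X p) = realization_map Y (\<lambda>n x. H n x (\<lambda>_. 0)) (cell_class X p)"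
      using k_eq[of 0 p] that realization_map_cell_class[OF e x t]
        prism_map_eq[OF x t order_refl prism_point_start(1)[OF x t]] prism_point_start(2)[OF x t] by (simp add: p)
    show "k (1, cell_class X p) = realization_map Y (\<lambda>n x. H n x (\<lambda>_. 1)) (cell_class X p)"
      using k_eq[of 1 p] that realization_map_cell_class[OF e x t]
        prism_map_eq[OF x t le0 prism_point_end(1)[OF x t]] prism_point_end(2)[OF x t] by (simp add: p)
  qed
  have "subtopology (realization X) (cell_class X ` ?T) = realization X"
    using topspace_realization[of X] by (metis subtopology_topspace)
  then show ?thesis
    using k ends by (subst homotopic_with) (auto intro!: exI[of _ k] simp: topspace_realization)
qed

end

section \<open>Nerves\<close>

lemma ordinal_category_simps [simp]:
  "Obj (ordinal_category n) = {..n}"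
  "f \<in> Arr (ordinal_category n) \<longleftrightarrow> fst f \<le> snd f \<and> snd f \<le> n"
  "Dom (ordinal_category n) = fst" "Cod (ordinal_category n) = snd"
  "Ide (ordinal_category n) i = (i, i)" "Comp (ordinal_category n) g f = (fst f, snd g)"
  by (cases f) (auto simp: ordinal_category_def thin_category_def)

lemma category_ordinal_category: "category (ordinal_category n)"
  unfolding ordinal_category_def by (rule category_thin_category) auto

lemma cat_functor_compose:
  assumes "cat_functor A B F" and "cat_functor B C G"
  shows "cat_functor A C (compose_functor A G F)"
proof -
  interpret F: cat_functor A B F by fact
  interpret G: cat_functor B C G by fact
  show ?thesis
    by unfold_locales
      (simp_all add: compose_functor_def compose_def F.source.Dom_closed F.source.Cod_closed
        F.source.Ide_closed F.source.Comp_closed F.source.Dom_Comp F.source.Cod_Comp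
        F.source.Dom_Ide F.source.Cod_Ide F.fobj_closed F.farr_closed
        F.Dom_farr F.Cod_farr F.farr_Ide F.farr_Comp
        G.fobj_closed G.farr_closed G.Dom_farr G.Cod_farr G.farr_Ide G.farr_Comp)
qed

lemma cat_functor_ordinal_map:
  assumes "\<theta> \<in> ordinal_maps m n"
  shows "cat_functor (ordinal_category m) (ordinal_category n) \<lparr>fobj = \<theta>, farr = map_prod \<theta> \<theta>\<rparr>"
proof -
  interpret M: category "ordinal_category m" by (rule category_ordinal_category)
  interpret N: category "ordinal_category n" by (rule category_ordinal_category)
  show ?thesis
    by unfold_locales (auto simp: ordinal_maps_le[OF assms] ordinal_maps_mono[OF assms])
qed

lemma Simp_nerve:
  "\<sigma> \<in> Simp (nerve C) n \<longleftrightarrow> cat_functor (ordinal_category n) C \<sigma> \<and>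
    fobj \<sigma> \<in> extensional {..n} \<and> farr \<sigma> \<in> extensional (Arr (ordinal_category n))"
  by (simp add: nerve_def)

lemma Act_nerve:
  "Act (nerve C) m n \<theta> \<sigma> = compose_functor (ordinal_category m) \<sigma> \<lparr>fobj = \<theta>, farr = map_prod \<theta> \<theta>\<rparr>"
  by (simp add: nerve_def)

text \<open>\<open>compose_functor\<close> restricts to \<open>[n]\<close>, which supplies the extensionality required in a nerve.\<close>

lemma compose_functor_in_nerve:
  assumes "cat_functor (ordinal_category n) A \<sigma>" and "cat_functor A C F"
  shows "compose_functor (ordinal_category n) F \<sigma> \<in> Simp (nerve C) n"
  unfolding Simp_nerve
  using cat_functor_compose[OF assms] by (simp add: compose_functor_def)

lemma compose_functor_eqI:
  assumes "\<And>x. x \<in> Obj A \<Longrightarrow> fobj G (fobj F x) = fobj G' (fobj F' x)"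
    and "\<And>f. f \<in> Arr A \<Longrightarrow> farr G (farr F f) = farr G' (farr F' f)"
  shows "compose_functor A G F = compose_functor A G' F'"
  using assms by (auto simp: compose_functor_def compose_def intro!: restrict_ext)

lemma simplicial_set_nerve:
  assumes "category C"
  shows "simplicial_set (nerve C)"
proof
  fix \<theta> m n \<sigma> assume "\<theta> \<in> ordinal_maps m n" and "\<sigma> \<in> Simp (nerve C) n"
  then show "Act (nerve C) m n \<theta> \<sigma> \<in> Simp (nerve C) m"
    unfolding Act_nerve
    by (intro compose_functor_in_nerve[OF cat_functor_ordinal_map]) (auto simp: Simp_nerve)
next
  fix \<eta> l m \<theta> n \<sigma>
  assume \<eta>: "\<eta> \<in> ordinal_maps l m" and "\<theta> \<in> ordinal_maps m n" and "\<sigma> \<in> Simp (nerve C) n"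
  show "Act (nerve C) l m \<eta> (Act (nerve C) m n \<theta> \<sigma>) = Act (nerve C) l n (\<theta> \<circ> \<eta>) \<sigma>"
    unfolding Act_nerve
    by (rule compose_functor_eqI)
      (auto simp: compose_functor_def compose_def ordinal_maps_le[OF \<eta>] ordinal_maps_mono[OF \<eta>])
next
  fix \<sigma> n m and \<theta> \<theta>' :: "nat \<Rightarrow> nat"
  assume "\<And>i. i \<le> m \<Longrightarrow> \<theta> i = \<theta>' i"
  then show "Act (nerve C) m n \<theta> \<sigma> = Act (nerve C) m n \<theta>' \<sigma>"
    unfolding Act_nerve by (intro compose_functor_eqI) auto
next
  fix \<sigma> n assume "\<sigma> \<in> Simp (nerve C) n"
  then show "Act (nerve C) n n (\<lambda>i. i) \<sigma> = \<sigma>"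
    unfolding Act_nerve Simp_nerve
    by (intro ftr.equality extensionalityI[of _ "{..n}"] extensionalityI[of _ "Arr (ordinal_category n)"])
      (auto simp: compose_functor_def compose_def map_prod_def)
qed

lemma simplicial_map_nerve_map:
  assumes "cat_functor C D F"
  shows "simplicial_map (nerve C) (nerve D) (nerve_map F)"
  unfolding simplicial_map_def
proof (intro conjI allI ballI)
  fix n \<sigma> assume "\<sigma> \<in> Simp (nerve C) n"
  then show "nerve_map F n \<sigma> \<in> Simp (nerve D) n"
    unfolding nerve_map_def using assms by (intro compose_functor_in_nerve) (auto simp: Simp_nerve)
next
  fix m n \<theta> \<sigma> assume \<theta>: "\<theta> \<in> ordinal_maps m n" and "\<sigma> \<in> Simp (nerve C) n"
  show "nerve_map F m (Act (nerve C) m n \<theta> \<sigma>) = Act (nerve D) m n \<theta> (nerve_map F n \<sigma>)"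
    unfolding Act_nerve nerve_map_def
    by (rule compose_functor_eqI)
      (auto simp: compose_functor_def compose_def ordinal_maps_le[OF \<theta>] ordinal_maps_mono[OF \<theta>])
qed

lemma cat_functor_subcategory:
  assumes "category C" and "subcategory U C"
  shows "cat_functor U C id_functor"
proof -
  interpret C: category C by fact
  interpret U: category U using assms(2) by (simp add: subcategory_def)
  show ?thesis
    using assms(2) by unfold_locales (auto simp: subcategory_def id_functor_def)
qed

lemma nerve_map_id:
  assumes "\<sigma> \<in> Simp (nerve C) n"
  shows "nerve_map id_functor n \<sigma> = \<sigma>"
  using assms unfolding nerve_map_def Simp_nerve
  by (intro ftr.equality extensionalityI[of _ "{..n}"] extensionalityI[of _ "Arr (ordinal_category n)"])
    (auto simp: compose_functor_def compose_def id_functor_def)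

lemma simplicial_subset_nerve:
  assumes "category C" and "subcategory U C"
  shows "simplicial_subset (nerve C) (nerve U)"
proof -
  interpret C: simplicial_set "nerve C"
    using assms(1) by (rule simplicial_set_nerve)
  interpret U: simplicial_set "nerve U"
    using assms(2) by (intro simplicial_set_nerve) (simp add: subcategory_def)
  have "\<sigma> \<in> Simp (nerve C) n" if "\<sigma> \<in> Simp (nerve U) n" for \<sigma> n
  proof -
    have "nerve_map id_functor n \<sigma> \<in> Simp (nerve C) n"
      using that simplicial_map_nerve_map[OF cat_functor_subcategory[OF assms]]
      unfolding simplicial_map_def by blast
    then show ?thesis
      using nerve_map_id[OF that] by simp
  qed
  then show ?thesis
    by unfold_locales (auto simp: nerve_def)
qed

lemma classifying_map_cell_class:
  assumes "cat_functor C D F" and "\<sigma> \<in> Simp (nerve C) n" and "t \<in> standard_simplex n"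
  shows "classifying_map D F (cell_class (nerve C) ((n, \<sigma>), t)) = cell_class (nerve D) ((n, nerve_map F n \<sigma>), t)"
  unfolding classifying_map_def
  by (rule realization_map_cell_class[OF simplicial_map_nerve_map[OF assms(1)] assms(2,3)])

lemma continuous_map_classifying_map:
  "cat_functor C D F \<Longrightarrow> continuous_map (classifying_space C) (classifying_space D) (classifying_map D F)"
  unfolding classifying_map_def classifying_space_def
  by (intro continuous_map_realization_map simplicial_map_nerve_map)

lemma topspace_classifying_space:
  assumes "c \<in> topspace (classifying_space C)"
  obtains n \<sigma> t where "\<sigma> \<in> Simp (nerve C) n" and "t \<in> standard_simplex n"
    and "c = cell_class (nerve C) ((n, \<sigma>), t)"
  using assms unfolding classifying_space_def topspace_realization
  by (auto simp: topspace_cell_space)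

lemma classifying_map_subcategory:
  assumes "category C" and "subcategory U C" and c: "c \<in> topspace (classifying_space U)"
  shows "classifying_map C id_functor c = realization_map (nerve C) (\<lambda>n \<sigma>. \<sigma>) c"
proof -
  interpret simplicial_subset "nerve C" "nerve U"
    using assms by (intro simplicial_subset_nerve)
  obtain n \<sigma> t where \<sigma>: "\<sigma> \<in> Simp (nerve U) n" "t \<in> standard_simplex n"
    and c: "c = cell_class (nerve U) ((n, \<sigma>), t)"
    using topspace_classifying_space[OF c] by blast
  have inc: "simplicial_map (nerve U) (nerve C) (\<lambda>n \<sigma>. \<sigma>)"
    using Simp_sub by (auto simp: simplicial_map_def Act_sub)
  show ?thesis
    unfolding c
    using classifying_map_cell_class[OF cat_functor_subcategory[OF assms(1,2)] \<sigma>]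
      realization_map_cell_class[OF inc \<sigma>] nerve_map_id[OF \<sigma>(1)] by simp
qed

section \<open>Homotopies of functors\<close>

text \<open>The functor \<open>H\<^sub>r\<close> of the homotopy \<open>H\<close>.\<close>

definition track :: "(('o \<times> nat), ('a \<times> nat \<times> nat), 'p, 'b) ftr \<Rightarrow> nat \<Rightarrow> ('o, 'a, 'p, 'b) ftr" where
  "track H r = \<lparr>fobj = (\<lambda>x. fobj H (x, r)), farr = (\<lambda>f. farr H (f, (r, r)))\<rparr>"

text \<open>The simplicial homotopy given by the natural transformation \<open>H\<^sub>r \<rightarrow> H\<^sub>s\<close> of an arrow \<open>r \<rightarrow> s\<close> of the
interval category: level \<open>0\<close> is sent to \<open>r\<close> and level \<open>1\<close> to \<open>s\<close>.\<close>

definition step_simplex ::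
    "(('o \<times> nat), ('a \<times> nat \<times> nat), 'p, 'b) ftr \<Rightarrow> nat \<Rightarrow> nat \<Rightarrow> nat \<Rightarrow>
      (nat, nat \<times> nat, 'o, 'a) ftr \<Rightarrow> (nat \<Rightarrow> nat) \<Rightarrow> (nat, nat \<times> nat, 'p, 'b) ftr" where
  "step_simplex H r s n \<sigma> q = compose_functor (ordinal_category n) H
    \<lparr>fobj = (\<lambda>i. (fobj \<sigma> i, if q i = 0 then r else s)),
     farr = (\<lambda>f. (farr \<sigma> f, (if q (fst f) = 0 then r else s, if q (snd f) = 0 then r else s)))\<rparr>"

lemma interval_category_simps [simp]:
  "Obj (interval_category m) = {..m}"
  "f \<in> Arr (interval_category m) \<longleftrightarrow> fst f \<le> m \<and> snd f \<le> m \<and>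
    (fst f = snd f \<or> even (fst f) \<and> (snd f = fst f + 1 \<or> fst f = snd f + 1))"
  "Dom (interval_category m) = fst" "Cod (interval_category m) = snd"
  "Ide (interval_category m) i = (i, i)" "Comp (interval_category m) g f = (fst f, snd g)"
  by (cases f) (auto simp: interval_category_def thin_category_def)

lemma simplicial_homotopy_step:
  assumes U: "category U" and H: "cat_functor (product_category U (interval_category m)) D H"
    and rs: "r \<le> m" "s \<le> m" "even r" "s = r + 1 \<or> r = s + 1"
  shows "simplicial_homotopy (nerve U) (nerve D) (step_simplex H r s)"
proof -
  interpret H: cat_functor "product_category U (interval_category m)" D H by fact
  interpret NU: simplicial_set "nerve U" using U by (rule simplicial_set_nerve)
  interpret ND: simplicial_set "nerve D" using H.target.category_axioms by (rule simplicial_set_nerve)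
  show ?thesis
  proof
    fix \<sigma> n and q :: "nat \<Rightarrow> nat"
    assume \<sigma>: "\<sigma> \<in> Simp (nerve U) n" and q: "q \<in> ordinal_maps n 1"
    interpret \<sigma>: cat_functor "ordinal_category n" U \<sigma>
      using \<sigma> by (simp add: Simp_nerve)
    have q01: "q j \<noteq> 0" if "q i \<noteq> 0" "i \<le> j" "j \<le> n" for i j
      using ordinal_maps_mono[OF q that(2,3)] that(1) by simp
    define c where "c i = (if q i = 0 then r else s)" for i
    have c: "c i \<le> m" for i
      using rs by (simp add: c_def)
    have c_arr: "(c i, c j) \<in> Arr (interval_category m)" if "i \<le> j" "j \<le> n" for i j
      using rs q01[OF _ that] by (auto simp: c_def)
    have "cat_functor (ordinal_category n) (product_category U (interval_category m))
        \<lparr>fobj = (\<lambda>i. (fobj \<sigma> i, c i)), farr = (\<lambda>f. (farr \<sigma> f, (c (fst f), c (snd f))))\<rparr>"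
    proof unfold_locales
      fix f g
      assume f: "f \<in> Arr (ordinal_category n)"
      show "farr \<lparr>fobj = (\<lambda>i. (fobj \<sigma> i, c i)), farr = (\<lambda>f. (farr \<sigma> f, (c (fst f), c (snd f))))\<rparr> f
          \<in> Arr (product_category U (interval_category m))"
        using \<sigma>.farr_closed[OF f] c_arr[of "fst f" "snd f"] f
        by (simp add: product_category_def del: interval_category_simps)
      assume g: "g \<in> Arr (ordinal_category n)" and fg: "Cod (ordinal_category n) f = Dom (ordinal_category n) g"
      show "farr \<lparr>fobj = (\<lambda>i. (fobj \<sigma> i, c i)), farr = (\<lambda>f. (farr \<sigma> f, (c (fst f), c (snd f))))\<rparr>
            (Comp (ordinal_category n) g f)
          = Comp (product_category U (interval_category m))
            (farr \<lparr>fobj = (\<lambda>i. (fobj \<sigma> i, c i)), farr = (\<lambda>f. (farr \<sigma> f, (c (fst f), c (snd f))))\<rparr> g)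
            (farr \<lparr>fobj = (\<lambda>i. (fobj \<sigma> i, c i)), farr = (\<lambda>f. (farr \<sigma> f, (c (fst f), c (snd f))))\<rparr> f)"
        using \<sigma>.farr_Comp[OF f g fg] by (simp add: product_category_def)
    qed (use c \<sigma>.fobj_closed \<sigma>.Dom_farr \<sigma>.Cod_farr \<sigma>.farr_Ide in \<open>simp_all add: product_category_def\<close>)
    then show "step_simplex H r s n \<sigma> q \<in> Simp (nerve D) n"
      unfolding step_simplex_def c_def using H by (rule compose_functor_in_nerve)
  next
    fix \<theta> l n \<sigma> and q :: "nat \<Rightarrow> nat"
    assume \<theta>: "\<theta> \<in> ordinal_maps l n"
    show "Act (nerve D) l n \<theta> (step_simplex H r s n \<sigma> q) = step_simplex H r s l (Act (nerve U) l n \<theta> \<sigma>) (q \<circ> \<theta>)"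
      unfolding Act_nerve step_simplex_def
      by (rule compose_functor_eqI)
        (auto simp: compose_functor_def compose_def ordinal_maps_le[OF \<theta>] ordinal_maps_mono[OF \<theta>])
  next
    fix \<sigma> n and q q' :: "nat \<Rightarrow> nat"
    assume "\<And>i. i \<le> n \<Longrightarrow> q i = q' i"
    then show "step_simplex H r s n \<sigma> q = step_simplex H r s n \<sigma> q'"
      unfolding step_simplex_def by (intro compose_functor_eqI) auto
  qed
qed

lemma homotopic_step:
  assumes U: "category U" and H: "cat_functor (product_category U (interval_category m)) D H"
    and rs: "r \<le> m" "s \<le> m" "even r" "s = r + 1 \<or> r = s + 1"
  shows "homotopic_with (\<lambda>_. True) (classifying_space U) (classifying_space D)
    (classifying_map D (track H r)) (classifying_map D (track H s))"
proof -
  interpret simplicial_homotopy "nerve U" "nerve D" "step_simplex H r s"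
    using assms by (rule simplicial_homotopy_step)
  have "step_simplex H r s n \<sigma> (\<lambda>_. 0) = nerve_map (track H r) n \<sigma>"
    "step_simplex H r s n \<sigma> (\<lambda>_. 1) = nerve_map (track H s) n \<sigma>" for n \<sigma>
    unfolding step_simplex_def nerve_map_def by (auto intro!: compose_functor_eqI simp: track_def)
  then show ?thesis
    using homotopic_realization_maps by (simp add: classifying_space_def classifying_map_def)
qed

text \<open>The arrows of the interval category start at even objects. So for odd \<open>r\<close> the natural transformation
between \<open>H\<^sub>r\<close> and \<open>H\<^bsub>r+1\<^esub>\<close> runs backwards, and its homotopy has to be reversed.\<close>

lemma homotopic_classifying_maps:
  assumes C: "category C" and sub: "subcategory U C"
    and F: "cat_functor C D F" and G: "cat_functor C D G"
    and hom: "homotopic_functors U D F G"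
  shows "homotopic_with (\<lambda>_. True) (classifying_space U) (classifying_space D)
    (classifying_map D F \<circ> classifying_map C id_functor)
    (classifying_map D G \<circ> classifying_map C id_functor)"
proof -
  have U: "category U"
    using sub by (simp add: subcategory_def)
  obtain m H where H: "cat_functor (product_category U (interval_category m)) D H"
    and obj: "\<And>x. x \<in> Obj U \<Longrightarrow> fobj H (x, 0) = fobj F x \<and> fobj H (x, m) = fobj G x"
    and arr: "\<And>f. f \<in> Arr U \<Longrightarrow> farr H (f, (0, 0)) = farr F f \<and> farr H (f, (m, m)) = farr G f"
    using hom unfolding homotopic_functors_def by auto
  have inc: "cat_functor U C id_functor"
    using C sub by (rule cat_functor_subcategory)
  have track0: "cat_functor U D (track H r)" if "r \<le> m" for r
  proof -
    interpret H: cat_functor "product_category U (interval_category m)" D H by fact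
    interpret U: category U by fact
    have "farr H (Ide U x, r, r) = Ide D (fobj H (x, r))" if "x \<in> Obj U" for x
      using H.farr_Ide[of "(x, r)"] that \<open>r \<le> m\<close> by (simp add: product_category_def)
    moreover have "farr H (Comp U g f, r, r) = Comp D (farr H (g, r, r)) (farr H (f, r, r))"
      if "f \<in> Arr U" "g \<in> Arr U" "Cod U f = Dom U g" for f g
      using H.farr_Comp[of "(f, r, r)" "(g, r, r)"] that \<open>r \<le> m\<close> by (simp add: product_category_def)
    moreover have "fobj H (x, r) \<in> Obj D" if "x \<in> Obj U" for x
      using H.fobj_closed[of "(x, r)"] that \<open>r \<le> m\<close> by (simp add: product_category_def)
    moreover have "farr H (f, r, r) \<in> Arr D" "Dom D (farr H (f, r, r)) = fobj H (Dom U f, r)"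
      "Cod D (farr H (f, r, r)) = fobj H (Cod U f, r)" if "f \<in> Arr U" for f
      using H.farr_closed[of "(f, r, r)"] H.Dom_farr[of "(f, r, r)"] H.Cod_farr[of "(f, r, r)"]
        that \<open>r \<le> m\<close> by (simp_all add: product_category_def)
    ultimately show ?thesis
      by unfold_locales (simp_all add: track_def)
  qed
  have "homotopic_with (\<lambda>_. True) (classifying_space U) (classifying_space D)
      (classifying_map D (track H 0)) (classifying_map D (track H r))" if "r \<le> m" for r
    using that
  proof (induction r)
    case 0
    then show ?case
      using continuous_map_classifying_map[OF track0[of 0]] by simp
  next
    case (Suc r)
    have "homotopic_with (\<lambda>_. True) (classifying_space U) (classifying_space D)
        (classifying_map D (track H r)) (classifying_map D (track H (Suc r)))"
    proof (cases "even r")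
      case True
      then show ?thesis
        using Suc.prems by (intro homotopic_step[OF U H]) auto
    next
      case False
      then have "homotopic_with (\<lambda>_. True) (classifying_space U) (classifying_space D)
          (classifying_map D (track H (Suc r))) (classifying_map D (track H r))"
        using Suc.prems by (intro homotopic_step[OF U H]) auto
      then show ?thesis
        by (rule homotopic_with_symD)
    qed
    then show ?case
      using Suc by (intro homotopic_with_trans[OF Suc.IH]) auto
  qed
  then have "homotopic_with (\<lambda>_. True) (classifying_space U) (classifying_space D)
      (classifying_map D (track H 0)) (classifying_map D (track H m))"
    by simp
  moreover have "homotopic_with (\<lambda>_. True) (classifying_space U) (classifying_space D)
      (classifying_map D K \<circ> classifying_map C id_functor) (classifying_map D (track H r))"
    if K: "cat_functor C D K" and "r \<le> m"
      and Ko: "\<And>x. x \<in> Obj U \<Longrightarrow> fobj H (x, r) = fobj K x"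
      and Ka: "\<And>f. f \<in> Arr U \<Longrightarrow> farr H (f, (r, r)) = farr K f" for K r
  proof (rule homotopic_with_equal)
    show "continuous_map (classifying_space U) (classifying_space D)
        (classifying_map D K \<circ> classifying_map C id_functor)"
      using continuous_map_classifying_map[OF inc] continuous_map_classifying_map[OF K]
      by (rule continuous_map_compose)
    fix c assume "c \<in> topspace (classifying_space U)"
    then obtain n \<sigma> t where \<sigma>: "\<sigma> \<in> Simp (nerve U) n" and t: "t \<in> standard_simplex n"
      and c: "c = cell_class (nerve U) ((n, \<sigma>), t)"
      using topspace_classifying_space by blast
    interpret simplicial_subset "nerve C" "nerve U"
      using C sub by (rule simplicial_subset_nerve)
    interpret \<sigma>: cat_functor "ordinal_category n" U \<sigma>
      using \<sigma> by (simp add: Simp_nerve)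
    have \<sigma>C: "\<sigma> \<in> Simp (nerve C) n"
      using \<sigma> Simp_sub by blast
    have "nerve_map K n \<sigma> = nerve_map (track H r) n \<sigma>"
      unfolding nerve_map_def
      using \<sigma>.fobj_closed \<sigma>.farr_closed by (intro compose_functor_eqI) (auto simp: track_def Ko Ka)
    then show "(classifying_map D K \<circ> classifying_map C id_functor) c = classifying_map D (track H r) c"
      using classifying_map_cell_class[OF inc \<sigma> t] classifying_map_cell_class[OF track0[OF \<open>r \<le> m\<close>] \<sigma> t]
        classifying_map_cell_class[OF K \<sigma>C t] nerve_map_id[OF \<sigma>] by (simp add: c)
  qed auto
  from this[OF F le0] this[OF G order_refl] have
    "homotopic_with (\<lambda>_. True) (classifying_space U) (classifying_space D)
      (classifying_map D F \<circ> classifying_map C id_functor) (classifying_map D (track H 0))"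
    "homotopic_with (\<lambda>_. True) (classifying_space U) (classifying_space D)
      (classifying_map D G \<circ> classifying_map C id_functor) (classifying_map D (track H m))"
    using obj arr by auto
  ultimately show ?thesis
    by (meson homotopic_with_symD homotopic_with_trans)
qed

section \<open>The inequalities\<close>

lemma geometric_cover_nerve:
  assumes C: "category C" and cover: "geometric_cover C I \<U>" and \<sigma>: "\<sigma> \<in> Simp (nerve C) n"
  shows "\<exists>i\<in>I. \<sigma> \<in> Simp (nerve (\<U> i)) n"
proof -
  interpret \<sigma>: cat_functor "ordinal_category n" C \<sigma>
    using \<sigma> by (simp add: Simp_nerve)
  \<comment> \<open>The final identity \<open>(n, n)\<close> keeps the string of arrows nonempty for \<open>n = 0\<close> and shows, for
    every \<open>n\<close>, that the last object belongs to the subcategory.\<close>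
  let ?e = "\<lambda>i. farr \<sigma> (i, min (Suc i) n)"
  let ?fs = "map ?e [0..<Suc n]"
  have arr: "farr \<sigma> (i, j) \<in> Arr C" "Dom C (farr \<sigma> (i, j)) = fobj \<sigma> i" "Cod C (farr \<sigma> (i, j)) = fobj \<sigma> j"
    if "i \<le> j" "j \<le> n" for i j
    using that \<sigma>.farr_closed[of "(i, j)"] \<sigma>.Dom_farr[of "(i, j)"] \<sigma>.Cod_farr[of "(i, j)"] by simp_all
  have "?fs \<noteq> []" by simp
  moreover have "set ?fs \<subseteq> Arr C"
    using arr(1) by (auto simp del: upt_Suc)
  moreover have "successively (\<lambda>f g. Cod C f = Dom C g) ?fs"
    unfolding successively_conv_nth using arr by (auto simp: nth_append simp del: upt_Suc)
  ultimately obtain i where i: "i \<in> I" and fs: "set ?fs \<subseteq> Arr (\<U> i)"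
    using cover unfolding geometric_cover_def by blast
  have sub: "subcategory (\<U> i) C"
    using cover i by (simp add: geometric_cover_def)
  interpret U: category "\<U> i"
    using sub by (simp add: subcategory_def)
  have U: "Dom (\<U> i) f = Dom C f" "Cod (\<U> i) f = Cod C f" if "f \<in> Arr (\<U> i)" for f
    using sub that by (auto simp: subcategory_def)
  have UIde: "Ide (\<U> i) x = Ide C x" if "x \<in> Obj (\<U> i)" for x
    using sub that by (auto simp: subcategory_def)
  have UComp: "Comp (\<U> i) g f = Comp C g f" if "f \<in> Arr (\<U> i)" "g \<in> Arr (\<U> i)" "Cod C f = Dom C g" for f g
    using sub that U by (auto simp: subcategory_def)
  have e: "?e j \<in> Arr (\<U> i)" if "j \<le> n" for j
    using fs that by (auto simp del: upt_Suc)
  have obj: "fobj \<sigma> j \<in> Obj (\<U> i)" if "j \<le> n" for j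
    using U.Dom_closed[OF e[OF that]] U(1)[OF e[OF that]] arr(2)[of j "min (Suc j) n"] that by simp
  have mem: "farr \<sigma> (j, k) \<in> Arr (\<U> i)" if "j \<le> k" "k \<le> n" for j k
    using that
  proof (induction k rule: dec_induct)
    case base
    then show ?case
      using \<sigma>.farr_Ide[of j] U.Ide_closed[OF obj] UIde[OF obj] by simp
  next
    case (step k)
    have k: "?e k = farr \<sigma> (k, Suc k)"
      using step by simp
    have "farr \<sigma> (j, Suc k) = Comp C (farr \<sigma> (k, Suc k)) (farr \<sigma> (j, k))"
      using \<sigma>.farr_Comp[of "(j, k)" "(k, Suc k)"] step by simp
    moreover have "farr \<sigma> (j, k) \<in> Arr (\<U> i)" "farr \<sigma> (k, Suc k) \<in> Arr (\<U> i)"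
      using step e[of k] by (simp_all add: k)
    moreover have "Cod C (farr \<sigma> (j, k)) = Dom C (farr \<sigma> (k, Suc k))"
      using step arr by simp
    ultimately show ?case
      using U.Comp_closed UComp U by metis
  qed
  have mem': "farr \<sigma> f \<in> Arr (\<U> i)" if "f \<in> Arr (ordinal_category n)" for f
    using mem[of "fst f" "snd f"] that by simp
  have "cat_functor (ordinal_category n) (\<U> i) \<sigma>"
  proof unfold_locales
    show "farr \<sigma> (Comp (ordinal_category n) g f) = Comp (\<U> i) (farr \<sigma> g) (farr \<sigma> f)"
      if "f \<in> Arr (ordinal_category n)" "g \<in> Arr (ordinal_category n)"
        "Cod (ordinal_category n) f = Dom (ordinal_category n) g" for f g
      using \<sigma>.farr_Comp[OF that] UComp[OF mem' mem', OF that(1,2)]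
        \<sigma>.Dom_farr[OF that(2)] \<sigma>.Cod_farr[OF that(1)] that(3) by simp
    show "farr \<sigma> f \<in> Arr (\<U> i)" "Dom (\<U> i) (farr \<sigma> f) = fobj \<sigma> (Dom (ordinal_category n) f)"
      "Cod (\<U> i) (farr \<sigma> f) = fobj \<sigma> (Cod (ordinal_category n) f)" if "f \<in> Arr (ordinal_category n)" for f
      using mem'[OF that] U[OF mem'[OF that]] \<sigma>.Dom_farr[OF that] \<sigma>.Cod_farr[OF that] by simp_all
    show "farr \<sigma> (Ide (ordinal_category n) x) = Ide (\<U> i) (fobj \<sigma> x)" if "x \<in> Obj (ordinal_category n)" for x
      using that \<sigma>.farr_Ide[OF that] UIde[OF obj] by simp
  qed (simp add: obj)
  then have "\<sigma> \<in> Simp (nerve (\<U> i)) n"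
    using \<sigma> by (simp add: Simp_nerve)
  with i show ?thesis by blast
qed

text \<open>On the neighbourhood \<open>W\<close> of \<open>BU\<close> with its map \<open>r\<close> to \<open>BU\<close>, the chain
\<open>BF \<simeq> BF \<circ> r \<simeq> BG \<circ> r \<simeq> BG\<close> of homotopies.\<close>

lemma homotopic_on_neighbourhood:
  assumes C: "category C" and sub: "subcategory U C"
    and F: "cat_functor C D F" and G: "cat_functor C D G"
    and hom: "homotopic_with (\<lambda>_. True) (classifying_space U) (classifying_space D)
      (classifying_map D F \<circ> classifying_map C id_functor)
      (classifying_map D G \<circ> classifying_map C id_functor)"
  shows "\<exists>W. openin (classifying_space C) W \<and>
    (\<forall>n. \<forall>\<sigma>\<in>Simp (nerve U) n. \<forall>t\<in>standard_simplex n. cell_class (nerve C) ((n, \<sigma>), t) \<in> W) \<and>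
    homotopic_with (\<lambda>_. True) (subtopology (classifying_space C) W) (classifying_space D)
      (classifying_map D F) (classifying_map D G)"
proof -
  interpret simplicial_subset "nerve C" "nerve U"
    using C sub by (rule simplicial_subset_nerve)
  obtain W r where W: "openin (classifying_space C) W"
    and cells: "\<And>n \<sigma> t. \<sigma> \<in> Simp (nerve U) n \<Longrightarrow> t \<in> standard_simplex n \<Longrightarrow> cell_class (nerve C) ((n, \<sigma>), t) \<in> W"
    and r: "continuous_map (subtopology (classifying_space C) W) (classifying_space U) r"
    and deform: "homotopic_with (\<lambda>_. True) (subtopology (classifying_space C) W) (classifying_space C)
      (\<lambda>c. c) (realization_map (nerve C) (\<lambda>n \<sigma>. \<sigma>) \<circ> r)"
    by (rule deformable_neighbourhood[folded classifying_space_def]) (rule that; assumption)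
  let ?i = "classifying_map C id_functor :: ('a, 'b) cspace_point \<Rightarrow> _"
  have retract: "homotopic_with (\<lambda>_. True) (subtopology (classifying_space C) W) (classifying_space D)
      (classifying_map D K) (classifying_map D K \<circ> ?i \<circ> r)" if K: "cat_functor C D K" for K
  proof -
    have "homotopic_with (\<lambda>_. True) (subtopology (classifying_space C) W) (classifying_space D)
        (classifying_map D K \<circ> (\<lambda>c. c)) (classifying_map D K \<circ> (realization_map (nerve C) (\<lambda>n \<sigma>. \<sigma>) \<circ> r))"
      by (rule homotopic_with_compose_continuous_map_left[OF deform continuous_map_classifying_map[OF K]]) simp
    moreover have "homotopic_with (\<lambda>_. True) (subtopology (classifying_space C) W) (classifying_space D)
        (classifying_map D K \<circ> (realization_map (nerve C) (\<lambda>n \<sigma>. \<sigma>) \<circ> r)) (classifying_map D K \<circ> ?i \<circ> r)"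
    proof (rule homotopic_with_equal)
      show "continuous_map (subtopology (classifying_space C) W) (classifying_space D)
          (classifying_map D K \<circ> (realization_map (nerve C) (\<lambda>n \<sigma>. \<sigma>) \<circ> r))"
        using homotopic_with_imp_continuous_maps[OF deform] continuous_map_classifying_map[OF K]
        by (blast intro: continuous_map_compose)
      fix c assume "c \<in> topspace (subtopology (classifying_space C) W)"
      then have "r c \<in> topspace (classifying_space U)"
        using r by (auto simp: continuous_map_def)
      then show "(classifying_map D K \<circ> (realization_map (nerve C) (\<lambda>n \<sigma>. \<sigma>) \<circ> r)) c = (classifying_map D K \<circ> ?i \<circ> r) c"
        using classifying_map_subcategory[OF C sub] by simp
    qed auto
    ultimately have "homotopic_with (\<lambda>_. True) (subtopology (classifying_space C) W) (classifying_space D)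
        (classifying_map D K \<circ> (\<lambda>c. c)) (classifying_map D K \<circ> ?i \<circ> r)"
      by (rule homotopic_with_trans)
    then show ?thesis
      by (simp add: o_def)
  qed
  have "homotopic_with (\<lambda>_. True) (subtopology (classifying_space C) W) (classifying_space D)
      (classifying_map D F \<circ> ?i \<circ> r) (classifying_map D G \<circ> ?i \<circ> r)"
    by (rule homotopic_with_compose_continuous_map_right[OF hom r]) simp
  then have "homotopic_with (\<lambda>_. True) (subtopology (classifying_space C) W) (classifying_space D)
      (classifying_map D F) (classifying_map D G)"
    using retract[OF F] retract[OF G] by (meson homotopic_with_symD homotopic_with_trans)
  then show ?thesis
    using W cells by blast
qed

theorem proposition4p17:
  fixes C :: "('o, 'a) cat" and D :: "('p, 'b) cat"
    and F G :: "('o, 'a, 'p, 'b) ftr"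
  assumes "connected_category C" and "connected_category D"
    and "cat_functor C D F" and "cat_functor C D G"
  shows "homotopic_distance (classifying_space C) (classifying_space D)
           (classifying_map D F) (classifying_map D G) \<le> weak_cat_distance C D F G
       \<and> weak_cat_distance C D F G \<le> cat_distance C D F G"
proof
  have C: "category C"
    using assms(1) by (simp add: connected_category_def)
  show "weak_cat_distance C D F G \<le> cat_distance C D F G"
    unfolding weak_cat_distance_def cat_distance_def
  proof (rule Inf_superset_mono, safe)
    fix n :: nat and \<U> assume cover: "geometric_cover C {..n} \<U>" and hom: "\<forall>j\<le>n. homotopic_functors (\<U> j) D F G"
    have "homotopic_with (\<lambda>_. True) (classifying_space (\<U> j)) (classifying_space D)
        (classifying_map D F \<circ> classifying_map C id_functor)
        (classifying_map D G \<circ> classifying_map C id_functor)" if "j \<le> n" for j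
      using cover hom that
      by (intro homotopic_classifying_maps[OF C _ assms(3,4)]) (auto simp: geometric_cover_def)
    with cover show "\<exists>n'. enat n = enat n' \<and> (\<exists>\<U>. geometric_cover C {..n'} \<U> \<and>
        (\<forall>j\<le>n'. homotopic_with (\<lambda>_. True) (classifying_space (\<U> j)) (classifying_space D)
          (classifying_map D F \<circ> classifying_map C id_functor)
          (classifying_map D G \<circ> classifying_map C id_functor)))"
      by blast
  qed
  show "homotopic_distance (classifying_space C) (classifying_space D)
      (classifying_map D F) (classifying_map D G) \<le> weak_cat_distance C D F G"
    unfolding weak_cat_distance_def homotopic_distance_def
  proof (rule Inf_superset_mono, safe)
    fix n :: nat and \<U> assume cover: "geometric_cover C {..n} \<U>"
      and hom: "\<forall>j\<le>n. homotopic_with (\<lambda>_. True) (classifying_space (\<U> j)) (classifying_space D)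
          (classifying_map D F \<circ> classifying_map C id_functor)
          (classifying_map D G \<circ> classifying_map C id_functor)"
    have "\<exists>W. openin (classifying_space C) W \<and>
        (\<forall>m. \<forall>\<sigma>\<in>Simp (nerve (\<U> j)) m. \<forall>t\<in>standard_simplex m. cell_class (nerve C) ((m, \<sigma>), t) \<in> W) \<and>
        homotopic_with (\<lambda>_. True) (subtopology (classifying_space C) W) (classifying_space D)
          (classifying_map D F) (classifying_map D G)" if "j \<le> n" for j
      using cover hom that
      by (intro homotopic_on_neighbourhood[OF C _ assms(3,4)]) (auto simp: geometric_cover_def)
    then obtain W where W: "\<And>j. j \<le> n \<Longrightarrow> openin (classifying_space C) (W j)"
      and cells: "\<And>j m \<sigma> t. j \<le> n \<Longrightarrow> \<sigma> \<in> Simp (nerve (\<U> j)) m \<Longrightarrow> t \<in> standard_simplex m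
        \<Longrightarrow> cell_class (nerve C) ((m, \<sigma>), t) \<in> W j"
      and homW: "\<And>j. j \<le> n \<Longrightarrow> homotopic_with (\<lambda>_. True) (subtopology (classifying_space C) (W j))
          (classifying_space D) (classifying_map D F) (classifying_map D G)"
      by metis
    have "c \<in> (\<Union>j\<le>n. W j)" if cC: "c \<in> topspace (classifying_space C)" for c
    proof -
      obtain m \<sigma> t where \<sigma>: "\<sigma> \<in> Simp (nerve C) m" "t \<in> standard_simplex m"
        and c: "c = cell_class (nerve C) ((m, \<sigma>), t)"
        using topspace_classifying_space[OF cC] by blast
      obtain j where "j \<le> n" "\<sigma> \<in> Simp (nerve (\<U> j)) m"
        using geometric_cover_nerve[OF C cover \<sigma>(1)] by auto
      then show ?thesis
        using cells \<sigma>(2) c by blast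
    qed
    moreover have "W j \<subseteq> topspace (classifying_space C)" if "j \<le> n" for j
      using W[OF that] by (rule openin_subset)
    ultimately have "(\<Union>j\<le>n. W j) = topspace (classifying_space C)"
      by blast
    with W homW show "\<exists>n'. enat n = enat n' \<and> (\<exists>W. (\<forall>j\<le>n'. openin (classifying_space C) (W j)) \<and>
        (\<Union>j\<le>n'. W j) = topspace (classifying_space C) \<and>
        (\<forall>j\<le>n'. homotopic_with (\<lambda>_. True) (subtopology (classifying_space C) (W j)) (classifying_space D)
          (classifying_map D F) (classifying_map D G)))"
      by blast
  qed
qed

end
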